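(* Let $U\subseteq G$ and $V\subseteq H$ be open subsets of topological groups $G$ and $H$, let $E$ be a locally convex space and $k,l\in\mathbb{N}_0\cup\{\infty\}$. Suppose that $U\times V\times\mathfrak{L}(G)^i\times\mathfrak{L}(H)^j$ is a $k_{\mathbb{R}}$-space for all $i,j\in\mathbb{N}_0$ with $i\leq k$, $j\leq l$. Then the map $$\Phi: C^{k,l}(U\times V,E)\to C^k(U,C^l(V,E)),\quad f\mapsto f^\vee,$$ where $f^\vee(x):=f(x,\bullet)$ for $x\in U$, is (well defined and) an isomorphism of topological vector spaces, i.e. a linear bijection that is a homeomorphism.
   Context: Conventions: all topological spaces (in particular topological groups and locally convex spaces) are Hausdorff; a locally convex space is a Hausdorff locally convex real topological vector space. $\mathbb{N}=\{1,2,\dots\}$, $\mathbb{N}_0=\mathbb{N}\cup\{0\}$. A Hausdorff space $X$ is a $k_{\mathbb{R}}$-space if a function $f:X\to\mathbb{R}$ is continuous if and only if $f|_K$ is continuous for each compact $K\subseteq X$. For a topological group $G$, $\mathfrak{L}(G)$ is the set of continuous group homomorphisms $\gamma:\mathbb{R}\to G$, with the compact-open topology. $C^k$-maps: let $U\subseteq G$ be open and $F$ a locally convex space. For $f:U\to F$, $x\in U$, $\gamma\in\mathfrak{L}(G)$ put $D_\gamma f(x):=\lim_{t\to0}\frac1t\big(f(x\cdot\gamma(t))-f(x)\big)$ if the limit exists. For $k\in\mathbb{N}_0\cup\{\infty\}$, $f$ is $C^k$ if $f$ is continuous and, for each $i\in\mathbb{N}$ with $i\le k$, the iterated derivatives $d^{(i)}f(x,\gamma_1,\dots,\gamma_i):=(D_{\gamma_i}\cdots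 D_{\gamma_1}f)(x)$ exist for all $x\in U$, $\gamma_1,\dots,\gamma_i\in\mathfrak{L}(G)$ and define a continuous map $d^{(i)}f:U\times\mathfrak{L}(G)^i\to F$. Put $d^{(0)}f:=f$. The space $C^k(U,F)$ of all $C^k$-maps carries the initial topology with respect to the maps $d^{(i)}:C^k(U,F)\to C(U\times\mathfrak{L}(G)^i,F)$, $f\mapsto d^{(i)}f$, $i\in\mathbb{N}_0$, $i\le k$, where the targets carry the compact-open topology; it is a Hausdorff locally convex space. $C^{k,l}$-maps: for $f:U\times V\to E$ put $D_{(\gamma,0)}f(x,y):=\lim_{t\to0}\frac1t(f(x\cdot\gamma(t),y)-f(x,y))$ for $\gamma\in\mathfrak{L}(G)$ and $D_{(0,\eta)}f(x,y):=\lim_{t\to0}\frac1t(f(x,y\cdot\eta(t))-f(x,y))$ for $\eta\in\mathfrak{L}(H)$, if the limits exist. A continuous map $f:U\times V\to E$ is $C^{k,l}$ if for all $i,j\in\mathbb{N}_0$ with $i\le k$, $j\le l$ the derivatives $$d^{(i,j)}f(x,y,\gamma_1,\dots,\gamma_i,\eta_1,\dots,\eta_j):=(D_{(\gamma_i,0)}\cdots D_{(\gamma_1,0)}D_{(0,\eta_j)}\cdots D_{(0,\eta_1)}f)(x,y)$$ exist for all $x\in U$, $y\in V$, $\gamma_1,\dots,\gamma_i\in\mathfrak{L}(G)$, $\eta_1,\dots,\eta_j\in\mathfrak{L}(H)$ and define continuous maps $d^{(i,j)}f:U\times V\times\mathfrak{L}(G)^i\times\mathfrak{L}(H)^j\to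 E$. The space $C^{k,l}(U\times V,E)$ of all such maps carries the initial topology with respect to the maps $f\mapsto d^{(i,j)}f$ into $C(U\times V\times\mathfrak{L}(G)^i\times\mathfrak{L}(H)^j,E)$ (compact-open topology), $i,j\in\mathbb{N}_0$, $i\le k$, $j\le l$; it is a Hausdorff locally convex space. *)

theory Defs
  imports "HOL-Analysis.Analysis" "HOL-Library.Function_Algebras"
begin

text \<open>
  Topological groups are types of class \<open>topological_group_add\<close>. That class is written
  additively but extends \<open>group_add\<close>, which is not commutative: \<open>x + \<gamma> t\<close> stands for the
  product of \<open>x\<close> and \<open>\<gamma> t\<close>.

  Since spaces of \<open>C\<^sup>k\<close>-maps have to serve as range spaces again, a locally convex space is
  not a type but a topology whose \<open>topspace\<close> is a vector subspace of a type of class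
  \<open>real_vector\<close>. Maps on an open set \<open>U\<close> with values in such a space are represented by
  total functions vanishing outside \<open>U\<close>; these form a vector subspace of the function type
  under the pointwise operations.
\<close>

instantiation "fun" :: (type, real_vector) real_vector
begin

definition scaleR_fun :: "real \<Rightarrow> ('a \<Rightarrow> 'b) \<Rightarrow> 'a \<Rightarrow> 'b" where
  "scaleR_fun a f = (\<lambda>x. a *\<^sub>R f x)"

instance
  by standard (simp_all add: scaleR_fun_def fun_eq_iff scaleR_add_right scaleR_add_left)

end

definition locally_convex_space :: "'a::real_vector topology \<Rightarrow> bool" where
  "locally_convex_space F \<longleftrightarrow>
     subspace (topspace F) \<and>
     Hausdorff_space F \<and>
     continuous_map (prod_topology F F) F (\<lambda>(x, y). x + y) \<and>
     continuous_map (prod_topology euclideanreal F) F (\<lambda>(a, x). a *\<^sub>R x) \<and>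
     (\<forall>W. openin F W \<and> 0 \<in> W \<longrightarrow> (\<exists>C. openin F C \<and> convex C \<and> 0 \<in> C \<and> C \<subseteq> W))"

definition kR_space :: "'a topology \<Rightarrow> bool" where
  "kR_space X \<longleftrightarrow>
     Hausdorff_space X \<and>
     (\<forall>f :: 'a \<Rightarrow> real.
        continuous_map X euclideanreal f \<longleftrightarrow>
        (\<forall>K. compactin X K \<longrightarrow> continuous_map (subtopology X K) euclideanreal f))"

text \<open>\<open>C(X,Y)\<close>: a continuous map is represented by its extensional representative, so that
  maps agreeing on \<open>topspace X\<close> are identified.\<close>

definition cmaps :: "'a topology \<Rightarrow> 'b topology \<Rightarrow> ('a \<Rightarrow> 'b) set" where
  "cmaps X Y = {f \<in> extensional (topspace X). continuous_map X Y f}"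

definition compact_open_topology :: "'a topology \<Rightarrow> 'b topology \<Rightarrow> ('a \<Rightarrow> 'b) topology" where
  "compact_open_topology X Y =
     topology_generated_by
       {{f \<in> cmaps X Y. f ` K \<subseteq> W} | K W. compactin X K \<and> openin Y W}"

definition initial_topology ::
    "'a set \<Rightarrow> 'i set \<Rightarrow> ('i \<Rightarrow> 'b topology) \<Rightarrow> ('i \<Rightarrow> 'a \<Rightarrow> 'b) \<Rightarrow> 'a topology" where
  "initial_topology S I Y d =
     topology_generated_by
       (insert S {{f \<in> S. d i f \<in> W} | i W. i \<in> I \<and> openin (Y i) W})"

text \<open>\<open>\<LL>(G)\<close>\<close>

definition one_param_groups :: "(real \<Rightarrow> 'g::{topological_group_add, t2_space}) set" where
  "one_param_groups = {\<gamma>. continuous_on UNIV \<gamma> \<and> (\<forall>s t. \<gamma> (s + t) = \<gamma> s + \<gamma> t)}"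

definition one_param_topology :: "(real \<Rightarrow> 'g::{topological_group_add, t2_space}) topology" where
  "one_param_topology =
     subtopology (compact_open_topology euclideanreal euclidean) one_param_groups"

text \<open>\<open>\<LL>(G)\<^sup>i\<close>, its elements being families \<open>(\<gamma> 1, \<dots>, \<gamma> i)\<close>; a one-point space for \<open>i = 0\<close>.\<close>

definition one_param_power ::
    "nat \<Rightarrow> (nat \<Rightarrow> real \<Rightarrow> 'g::{topological_group_add, t2_space}) topology" where
  "one_param_power i = product_topology (\<lambda>_. one_param_topology) {1..i}"

text \<open>Directional derivatives. For \<open>x\<close> in an open set \<open>U\<close>, only the values of \<open>f\<close> on \<open>U\<close> matter.\<close>

definition has_D ::
    "'f::real_vector topology \<Rightarrow> (real \<Rightarrow> 'g::{topological_group_add, t2_space}) \<Rightarrow>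
     ('g \<Rightarrow> 'f) \<Rightarrow> 'g \<Rightarrow> 'f \<Rightarrow> bool" where
  "has_D F \<gamma> f x v \<longleftrightarrow> limitin F (\<lambda>t. (1 / t) *\<^sub>R (f (x + \<gamma> t) - f x)) v (at 0)"

definition dir_D ::
    "'f::real_vector topology \<Rightarrow> (real \<Rightarrow> 'g::{topological_group_add, t2_space}) \<Rightarrow>
     ('g \<Rightarrow> 'f) \<Rightarrow> 'g \<Rightarrow> 'f" where
  "dir_D F \<gamma> f x = (THE v. has_D F \<gamma> f x v)"

text \<open>\<open>iter_D F \<gamma> f i\<close> is \<open>D\<^bsub>\<gamma> i\<^esub> \<cdots> D\<^bsub>\<gamma> 1\<^esub> f\<close>.\<close>

primrec iter_D ::
    "'f::real_vector topology \<Rightarrow> (nat \<Rightarrow> real \<Rightarrow> 'g::{topological_group_add, t2_space}) \<Rightarrow>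
     ('g \<Rightarrow> 'f) \<Rightarrow> nat \<Rightarrow> 'g \<Rightarrow> 'f" where
  "iter_D F \<gamma> f 0 = f"
| "iter_D F \<gamma> f (Suc i) = dir_D F (\<gamma> (Suc i)) (iter_D F \<gamma> f i)"

definition iter_D_exists ::
    "'g set \<Rightarrow> 'f::real_vector topology \<Rightarrow>
     (nat \<Rightarrow> real \<Rightarrow> 'g::{topological_group_add, t2_space}) \<Rightarrow> ('g \<Rightarrow> 'f) \<Rightarrow> nat \<Rightarrow> bool" where
  "iter_D_exists U F \<gamma> f i \<longleftrightarrow>
     (\<forall>n<i. \<forall>x\<in>U. \<exists>v. has_D F (\<gamma> (Suc n)) (iter_D F \<gamma> f n) x v)"

definition Ck_dom ::
    "'g::{topological_group_add, t2_space} set \<Rightarrow> nat \<Rightarrow>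
     ('g \<times> (nat \<Rightarrow> real \<Rightarrow> 'g)) topology" where
  "Ck_dom U i = prod_topology (top_of_set U) (one_param_power i)"

definition Ck_d ::
    "'g set \<Rightarrow> 'f::real_vector topology \<Rightarrow> nat \<Rightarrow> ('g \<Rightarrow> 'f) \<Rightarrow>
     'g::{topological_group_add, t2_space} \<times> (nat \<Rightarrow> real \<Rightarrow> 'g) \<Rightarrow> 'f" where
  "Ck_d U F i f = restrict (\<lambda>(x, \<gamma>). iter_D F \<gamma> f i x) (topspace (Ck_dom U i))"

definition Ck ::
    "'g::{topological_group_add, t2_space} set \<Rightarrow> 'f::real_vector topology \<Rightarrow> enat \<Rightarrow>
     ('g \<Rightarrow> 'f) set" where
  "Ck U F k =
     {f. (\<forall>x. x \<notin> U \<longrightarrow> f x = 0) \<and>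
         continuous_map (top_of_set U) F f \<and>
         (\<forall>i\<ge>1. enat i \<le> k \<longrightarrow>
            (\<forall>\<gamma>\<in>topspace (one_param_power i). iter_D_exists U F \<gamma> f i) \<and>
            continuous_map (Ck_dom U i) F (Ck_d U F i f))}"

definition Ck_topology ::
    "'g::{topological_group_add, t2_space} set \<Rightarrow> 'f::real_vector topology \<Rightarrow> enat \<Rightarrow>
     ('g \<Rightarrow> 'f) topology" where
  "Ck_topology U F k =
     initial_topology (Ck U F k) {i. enat i \<le> k}
       (\<lambda>i. compact_open_topology (Ck_dom U i) F) (Ck_d U F)"

text \<open>\<open>D_fst E \<gamma>\<close> is \<open>D\<^bsub>(\<gamma>,0)\<^esub>\<close> and \<open>D_snd E \<eta>\<close> is \<open>D\<^bsub>(0,\<eta>)\<^esub>\<close>.\<close>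

definition D_fst ::
    "'e::real_vector topology \<Rightarrow> (real \<Rightarrow> 'g::{topological_group_add, t2_space}) \<Rightarrow>
     ('g \<times> 'h \<Rightarrow> 'e) \<Rightarrow> 'g \<times> 'h \<Rightarrow> 'e" where
  "D_fst E \<gamma> f = (\<lambda>(x, y). dir_D E \<gamma> (\<lambda>x'. f (x', y)) x)"

definition D_snd ::
    "'e::real_vector topology \<Rightarrow> (real \<Rightarrow> 'h::{topological_group_add, t2_space}) \<Rightarrow>
     ('g \<times> 'h \<Rightarrow> 'e) \<Rightarrow> 'g \<times> 'h \<Rightarrow> 'e" where
  "D_snd E \<eta> f = (\<lambda>(x, y). dir_D E \<eta> (\<lambda>y'. f (x, y')) y)"

primrec iter_D_fst ::
    "'e::real_vector topology \<Rightarrow> (nat \<Rightarrow> real \<Rightarrow> 'g::{topological_group_add, t2_space}) \<Rightarrow>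
     ('g \<times> 'h \<Rightarrow> 'e) \<Rightarrow> nat \<Rightarrow> 'g \<times> 'h \<Rightarrow> 'e" where
  "iter_D_fst E \<gamma> f 0 = f"
| "iter_D_fst E \<gamma> f (Suc i) = D_fst E (\<gamma> (Suc i)) (iter_D_fst E \<gamma> f i)"

primrec iter_D_snd ::
    "'e::real_vector topology \<Rightarrow> (nat \<Rightarrow> real \<Rightarrow> 'h::{topological_group_add, t2_space}) \<Rightarrow>
     ('g \<times> 'h \<Rightarrow> 'e) \<Rightarrow> nat \<Rightarrow> 'g \<times> 'h \<Rightarrow> 'e" where
  "iter_D_snd E \<eta> f 0 = f"
| "iter_D_snd E \<eta> f (Suc j) = D_snd E (\<eta> (Suc j)) (iter_D_snd E \<eta> f j)"

definition mixed_D_exists ::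
    "'g set \<Rightarrow> 'h set \<Rightarrow> 'e::real_vector topology \<Rightarrow>
     (nat \<Rightarrow> real \<Rightarrow> 'g::{topological_group_add, t2_space}) \<Rightarrow>
     (nat \<Rightarrow> real \<Rightarrow> 'h::{topological_group_add, t2_space}) \<Rightarrow>
     ('g \<times> 'h \<Rightarrow> 'e) \<Rightarrow> nat \<Rightarrow> nat \<Rightarrow> bool" where
  "mixed_D_exists U V E \<gamma> \<eta> f i j \<longleftrightarrow>
     (\<forall>n<j. \<forall>x\<in>U. \<forall>y\<in>V. \<exists>v.
        has_D E (\<eta> (Suc n)) (\<lambda>y'. iter_D_snd E \<eta> f n (x, y')) y v) \<and>
     (\<forall>n<i. \<forall>x\<in>U. \<forall>y\<in>V. \<exists>v.
        has_D E (\<gamma> (Suc n)) (\<lambda>x'. iter_D_fst E \<gamma> (iter_D_snd E \<eta> f j) n (x', y)) x v)"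

definition Ckl_dom ::
    "'g::{topological_group_add, t2_space} set \<Rightarrow> 'h::{topological_group_add, t2_space} set \<Rightarrow>
     nat \<Rightarrow> nat \<Rightarrow>
     (('g \<times> 'h) \<times> (nat \<Rightarrow> real \<Rightarrow> 'g) \<times> (nat \<Rightarrow> real \<Rightarrow> 'h)) topology" where
  "Ckl_dom U V i j =
     prod_topology (prod_topology (top_of_set U) (top_of_set V))
       (prod_topology (one_param_power i) (one_param_power j))"

definition Ckl_d ::
    "'g set \<Rightarrow> 'h set \<Rightarrow> 'e::real_vector topology \<Rightarrow> nat \<Rightarrow> nat \<Rightarrow> ('g \<times> 'h \<Rightarrow> 'e) \<Rightarrow>
     ('g::{topological_group_add, t2_space} \<times> 'h::{topological_group_add, t2_space}) \<times>
       (nat \<Rightarrow> real \<Rightarrow> 'g) \<times> (nat \<Rightarrow> real \<Rightarrow> 'h) \<Rightarrow> 'e" where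
  "Ckl_d U V E i j f =
     restrict (\<lambda>(p, \<gamma>, \<eta>). iter_D_fst E \<gamma> (iter_D_snd E \<eta> f j) i p) (topspace (Ckl_dom U V i j))"

definition Ckl ::
    "'g::{topological_group_add, t2_space} set \<Rightarrow> 'h::{topological_group_add, t2_space} set \<Rightarrow>
     'e::real_vector topology \<Rightarrow> enat \<Rightarrow> enat \<Rightarrow> ('g \<times> 'h \<Rightarrow> 'e) set" where
  "Ckl U V E k l =
     {f. (\<forall>p. p \<notin> U \<times> V \<longrightarrow> f p = 0) \<and>
         continuous_map (prod_topology (top_of_set U) (top_of_set V)) E f \<and>
         (\<forall>i j. enat i \<le> k \<and> enat j \<le> l \<longrightarrow>
            (\<forall>\<gamma>\<in>topspace (one_param_power i). \<forall>\<eta>\<in>topspace (one_param_power j).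
               mixed_D_exists U V E \<gamma> \<eta> f i j) \<and>
            continuous_map (Ckl_dom U V i j) E (Ckl_d U V E i j f))}"

definition Ckl_topology ::
    "'g::{topological_group_add, t2_space} set \<Rightarrow> 'h::{topological_group_add, t2_space} set \<Rightarrow>
     'e::real_vector topology \<Rightarrow> enat \<Rightarrow> enat \<Rightarrow> ('g \<times> 'h \<Rightarrow> 'e) topology" where
  "Ckl_topology U V E k l =
     initial_topology (Ckl U V E k l) {(i, j). enat i \<le> k \<and> enat j \<le> l}
       (\<lambda>(i, j). compact_open_topology (Ckl_dom U V i j) E) (\<lambda>(i, j). Ckl_d U V E i j)"

text \<open>Isomorphisms between topological vector spaces carried by subspaces of \<open>real_vector\<close> types.
  As \<open>\<Phi>\<close> is only relevant on \<open>topspace X\<close>, linearity is required only there.\<close>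

definition tvs_isomorphism ::
    "'a::real_vector topology \<Rightarrow> 'b::real_vector topology \<Rightarrow> ('a \<Rightarrow> 'b) \<Rightarrow> bool" where
  "tvs_isomorphism X Y \<Phi> \<longleftrightarrow>
     subspace (topspace X) \<and> subspace (topspace Y) \<and>
     (\<forall>f\<in>topspace X. \<forall>g\<in>topspace X. \<Phi> (f + g) = \<Phi> f + \<Phi> g) \<and>
     (\<forall>a. \<forall>f\<in>topspace X. \<Phi> (a *\<^sub>R f) = a *\<^sub>R \<Phi> f) \<and>
     bij_betw \<Phi> (topspace X) (topspace Y) \<and>
     homeomorphic_map X Y \<Phi>"

lemma topspace_initial_topology [simp]: "topspace (initial_topology S I Y d) = S"
  unfolding initial_topology_def topology_generated_by_topspace by auto

lemma topspace_Ck_topology [simp]: "topspace (Ck_topology U F k) = Ck U F k"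
  by (simp add: Ck_topology_def)

lemma topspace_Ckl_topology [simp]: "topspace (Ckl_topology U V E k l) = Ckl U V E k l"
  by (simp add: Ckl_topology_def)

end

(*
  Currying turns d^(i,j) f into d^(j) (d^(i) f^v). For this, f has to be differentiated in the
  opposite order as well (Schwarz), and the difference quotients of f^v have to converge uniformly
  on compact sets. Both follow from the mean value theorem in the form that a curve whose velocity
  stays in an open convex set C has its difference quotients in C; no completeness is needed.

  The topologies are handled by one principle: for Hausdorff X, a map from T to C(X,Y) is
  continuous iff its uncurried form is continuous on T x K for every compact K in X. It gives the
  continuity of the isomorphism and of its inverse, and it shows that the uncurried derivatives are
  continuous on compact sets. The k_R-property extends the latter to the whole domain, since the
  topology of E is determined by real-valued continuous functions (Minkowski gauges).
*)
theory Submission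
  imports Defs
begin

section \<open>Initial and compact-open topologies\<close>

text \<open>The two directions differ in the order of differentiation. In d^(i,j) the
  \<open>\<eta>\<close>-derivatives are innermost, whereas applying d^(j) to d^(i) of the curried
  map puts the \<open>\<gamma>\<close>-derivatives innermost; hence currying needs the exchange. In
  the converse direction the point evaluations of d^(j) are continuous and linear on the function
  space, so they commute with directional derivatives and deliver the
  \<open>\<eta>\<close>-derivatives innermost at once. The obstacle in the converse direction is
  continuity: evaluation C(X,Y) x X -> Y need not be continuous unless X is locally compact, and
  nothing of this kind is assumed of the domains, which contain powers of \<LL>(G) and \<LL>(H).
  Derivatives are chosen by \<open>THE\<close>, and \<open>iter_D\<close> is uncontrolled off the
  open set. Iterated derivatives are therefore computed by exhibiting the whole chain of
  intermediate derivatives on the open set and verifying each link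
  (\<open>iter_D_eqI\<close>).\<close>

text \<open>Eventual membership survives finite intersections and arbitrary unions, so convergence
  can be tested on a subbasis.\<close>

lemma limitin_topology_generated_by:
  "limitin (topology_generated_by B) f a F \<longleftrightarrow>
     a \<in> \<Union>B \<and> (\<forall>b\<in>B. a \<in> b \<longrightarrow> (\<forall>\<^sub>F t in F. f t \<in> b))"
proof
  assume "limitin (topology_generated_by B) f a F"
  then show "a \<in> \<Union>B \<and> (\<forall>b\<in>B. a \<in> b \<longrightarrow> (\<forall>\<^sub>F t in F. f t \<in> b))"
    by (auto simp: limitin_def topology_generated_by_topspace intro: topology_generated_by_Basis)
next
  assume B: "a \<in> \<Union>B \<and> (\<forall>b\<in>B. a \<in> b \<longrightarrow> (\<forall>\<^sub>F t in F. f t \<in> b))"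
  have "a \<in> W \<longrightarrow> (\<forall>\<^sub>F t in F. f t \<in> W)" if "generate_topology_on B W" for W
    using that
  proof induction
    case (Int a b)
    then show ?case by (auto intro: eventually_conj)
  next
    case (UN K)
    show ?case
    proof
      assume "a \<in> \<Union>K"
      then obtain k where "k \<in> K" "a \<in> k" by blast
      then have "\<forall>\<^sub>F t in F. f t \<in> k" using UN by blast
      then show "\<forall>\<^sub>F t in F. f t \<in> \<Union>K"
        using \<open>k \<in> K\<close> by (auto elim: eventually_mono)
    qed
  qed (use B in auto)
  then show "limitin (topology_generated_by B) f a F"
    using B by (auto simp: limitin_def topology_generated_by_topspace openin_topology_generated_by_iff)
qed

lemma continuous_map_into_initial_topology:
  assumes "\<Psi> \<in> topspace T \<rightarrow> S"
    and "\<And>i. i \<in> I \<Longrightarrow> continuous_map T (Y i) (\<lambda>t. d i (\<Psi> t))"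
  shows "continuous_map T (initial_topology S I Y d) \<Psi>"
  unfolding initial_topology_def
proof (rule continuous_on_generated_topo)
  fix W assume W: "W \<in> insert S {{f \<in> S. d i f \<in> W} | i W. i \<in> I \<and> openin (Y i) W}"
  have "openin T {t \<in> topspace T. d i (\<Psi> t) \<in> W'}" if "i \<in> I" "openin (Y i) W'" for i W'
    using openin_continuous_map_preimage assms(2) that by fastforce
  moreover have "\<Psi> -` {f \<in> S. d i f \<in> W'} \<inter> topspace T = {t \<in> topspace T. d i (\<Psi> t) \<in> W'}" for i W'
    using assms(1) by auto
  moreover have "\<Psi> -` S \<inter> topspace T = topspace T"
    using assms(1) by auto
  ultimately show "openin T (\<Psi> -` W \<inter> topspace T)"
    using W by auto
qed (use assms(1) in auto)

lemma continuous_map_from_initial_topology: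
  assumes "i \<in> I" and "d i \<in> S \<rightarrow> topspace (Y i)"
  shows "continuous_map (initial_topology S I Y d) (Y i) (d i)"
  unfolding continuous_map_def topspace_initial_topology
proof (intro conjI allI impI)
  fix W assume "openin (Y i) W"
  then show "openin (initial_topology S I Y d) {x \<in> S. d i x \<in> W}"
    unfolding initial_topology_def using assms(1)
    by (intro topology_generated_by_Basis) auto
qed (use assms in auto)

text \<open>Membership of \<open>f t\<close> in \<open>S\<close> is asked for only eventually: a
  difference quotient at \<open>x\<close> is known to lie in the function space only once
  \<open>x + \<gamma> t\<close> lies in \<open>U\<close>.\<close>

lemma limitin_initial_topology:
  assumes "a \<in> S" and "\<forall>\<^sub>F t in F. f t \<in> S"
    and "\<And>i. i \<in> I \<Longrightarrow> limitin (Y i) (\<lambda>t. d i (f t)) (d i a) F"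
  shows "limitin (initial_topology S I Y d) f a F"
  unfolding initial_topology_def limitin_topology_generated_by
proof (intro conjI ballI impI)
  fix b assume "b \<in> insert S {{f \<in> S. d i f \<in> W} | i W. i \<in> I \<and> openin (Y i) W}" and ab: "a \<in> b"
  then consider "b = S" | i W where "b = {f \<in> S. d i f \<in> W}" "i \<in> I" "openin (Y i) W"
    by blast
  then show "\<forall>\<^sub>F t in F. f t \<in> b"
  proof cases
    case 2
    then show ?thesis
      using assms(2) limitinD[OF assms(3)[OF 2(2)] 2(3)] ab by (auto intro: eventually_conj)
  qed (use assms in simp)
qed (use assms in auto)

section \<open>The compact-open topology: currying and uncurrying\<close>

lemma topspace_compact_open_topology [simp]: "topspace (compact_open_topology X Y) = cmaps X Y"
proof -
  \<comment> \<open>The subbasic set of the empty compact set is all of \<open>cmaps X Y\<close>, so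
    the subbasis covers.\<close>
  have "cmaps X Y = {f \<in> cmaps X Y. f ` {} \<subseteq> {}}" "compactin X {}" "openin Y {}"
    by auto
  then show ?thesis
    unfolding compact_open_topology_def topology_generated_by_topspace by blast
qed

lemma openin_compact_open_topology:
  "compactin X K \<Longrightarrow> openin Y W \<Longrightarrow>
    openin (compact_open_topology X Y) {f \<in> cmaps X Y. f ` K \<subseteq> W}"
  unfolding compact_open_topology_def by (intro topology_generated_by_Basis) auto

lemma limitin_compact_open_topology:
  assumes "a \<in> cmaps X Y" and "\<forall>\<^sub>F t in F. f t \<in> cmaps X Y"
    and "\<And>K W. compactin X K \<Longrightarrow> openin Y W \<Longrightarrow> a ` K \<subseteq> W \<Longrightarrow> \<forall>\<^sub>F t in F. f t ` K \<subseteq> W"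
  shows "limitin (compact_open_topology X Y) f a F"
proof -
  have "a \<in> topspace (compact_open_topology X Y)"
    using assms(1) by simp
  then show ?thesis
    unfolding compact_open_topology_def limitin_topology_generated_by topology_generated_by_topspace
    using assms by (auto intro!: eventually_conj)
qed

lemma Hausdorff_space_compact_open_topology:
  assumes "Hausdorff_space Y"
  shows "Hausdorff_space (compact_open_topology X Y)"
  unfolding Hausdorff_space_def topspace_compact_open_topology
proof (intro allI impI)
  fix f g assume fg: "f \<in> cmaps X Y \<and> g \<in> cmaps X Y \<and> f \<noteq> g"
  then obtain x where x: "x \<in> topspace X" "f x \<noteq> g x"
    unfolding cmaps_def by (metis (no_types, lifting) IntE extensionalityI mem_Collect_eq)
  have "f x \<in> topspace Y" "g x \<in> topspace Y"
    using fg x by (auto simp: cmaps_def continuous_map_def)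
  then obtain A B where AB: "openin Y A" "openin Y B" "f x \<in> A" "g x \<in> B" "disjnt A B"
    using assms x(2) by (metis Hausdorff_space_def)
  have "compactin X {x}" using x by simp
  then show "\<exists>A B. openin (compact_open_topology X Y) A \<and> openin (compact_open_topology X Y) B
      \<and> f \<in> A \<and> g \<in> B \<and> disjnt A B"
    using AB fg openin_compact_open_topology[of X "{x}"]
    by (intro exI[of _ "{h \<in> cmaps X Y. h ` {x} \<subseteq> A}"] exI[of _ "{h \<in> cmaps X Y. h ` {x} \<subseteq> B}"])
       (auto simp: disjnt_iff)
qed

text \<open>Projection along a compact factor is a closed map. The parameters \<open>t\<close> for
  which \<open>\<Psi> t\<close> leaves the open set somewhere on \<open>K\<close> form the
  projection of a closed subset of T x K, hence a closed set.\<close>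

lemma continuous_map_into_compact_open_topology:
  assumes \<Psi>: "\<Psi> \<in> topspace T \<rightarrow> cmaps X Y"
    and cont: "\<And>K. compactin X K \<Longrightarrow>
      continuous_map (prod_topology T (subtopology X K)) Y (\<lambda>(t, x). \<Psi> t x)"
  shows "continuous_map T (compact_open_topology X Y) \<Psi>"
  unfolding compact_open_topology_def
proof (rule continuous_on_generated_topo)
  fix W assume "W \<in> {{f \<in> cmaps X Y. f ` K \<subseteq> W} | K W. compactin X K \<and> openin Y W}"
  then obtain K W' where W: "W = {f \<in> cmaps X Y. f ` K \<subseteq> W'}" and K: "compactin X K"
    and W': "openin Y W'" by auto
  let ?P = "prod_topology T (subtopology X K)"
  let ?C = "{p \<in> topspace ?P. (\<lambda>(t, x). \<Psi> t x) p \<in> topspace Y - W'}"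
  have "closedin ?P ?C"
    using closedin_continuous_map_preimage[OF cont[OF K]] W' by blast
  moreover have "closed_map ?P T fst"
    using K by (intro closed_map_fst) (simp add: compactin_subspace)
  ultimately have "closedin T (fst ` ?C)"
    by (auto simp: closed_map_def)
  moreover have "\<Psi> -` W \<inter> topspace T = topspace T - fst ` ?C"
    using \<Psi> compactin_subset_topspace[OF K]
    by (fastforce simp: W image_iff cmaps_def continuous_map_def Pi_iff subset_iff)
  ultimately show "openin T (\<Psi> -` W \<inter> topspace T)"
    by auto
next
  show "\<Psi> ` topspace T \<subseteq> \<Union>{{f \<in> cmaps X Y. f ` K \<subseteq> W} | K W. compactin X K \<and> openin Y W}"
    using \<Psi> topspace_compact_open_topology[of X Y]
    unfolding compact_open_topology_def topology_generated_by_topspace by auto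
qed

lemma continuous_map_curry_compact_open:
  assumes "\<And>t. t \<in> topspace T \<Longrightarrow> \<Psi> t \<in> extensional (topspace X)"
    and cont: "continuous_map (prod_topology T X) Y (\<lambda>(t, x). \<Psi> t x)"
  shows "continuous_map T (compact_open_topology X Y) \<Psi>"
proof (rule continuous_map_into_compact_open_topology)
  show "\<Psi> \<in> topspace T \<rightarrow> cmaps X Y"
  proof
    fix t assume t: "t \<in> topspace T"
    have "continuous_map X (prod_topology T X) (Pair t)"
      using t by (simp add: continuous_map_pairwise o_def)
    from continuous_map_compose[OF this cont] show "\<Psi> t \<in> cmaps X Y"
      using assms(1)[OF t] by (simp add: cmaps_def o_def)
  qed
  fix K assume "compactin X K"
  show "continuous_map (prod_topology T (subtopology X K)) Y (\<lambda>(t, x). \<Psi> t x)"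
    by (rule continuous_map_compose[OF _ cont, of _ id, unfolded o_def id_apply])
       (simp add: continuous_map_pairwise o_def continuous_map_fst
          continuous_map_snd[THEN continuous_map_into_fulltopology] id_def)
qed

text \<open>A compact Hausdorff \<open>K\<close> is regular, so each of its points has arbitrarily
  small closed, hence compact, neighbourhoods \<open>M\<close> in \<open>K\<close>. If
  \<open>\<Psi> t\<close> maps \<open>M\<close> into \<open>W\<close>, then so does
  \<open>\<Psi> t'\<close> for all \<open>t'\<close> near \<open>t\<close>, because this is a
  subbasic condition.\<close>

lemma continuous_map_uncurry_compact_open:
  assumes \<Psi>: "continuous_map T (compact_open_topology X Y) \<Psi>"
    and X: "Hausdorff_space X" and K: "compactin X K"
  shows "continuous_map (prod_topology T (subtopology X K)) Y (\<lambda>(t, x). \<Psi> t x)"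
proof -
  let ?K = "subtopology X K"
  have \<Psi>c: "continuous_map X Y (\<Psi> t)" if "t \<in> topspace T" for t
    using \<Psi> that by (auto simp: continuous_map_def cmaps_def Pi_iff)
  have "regular_space ?K"
    using X K by (intro compact_Hausdorff_imp_regular_space)
       (auto simp: compactin_subspace Hausdorff_space_subtopology)
  then have nb: "neighbourhood_base_of (closedin ?K) ?K"
    by (simp add: neighbourhood_base_of_closedin)
  show ?thesis
    unfolding continuous_map_def
  proof (intro conjI allI impI)
    show "(\<lambda>(t, x). \<Psi> t x) \<in> topspace (prod_topology T ?K) \<rightarrow> topspace Y"
      using \<Psi>c by (auto simp: continuous_map_def Pi_iff)
    fix W assume W: "openin Y W"
    let ?P = "{p \<in> topspace (prod_topology T ?K). (\<lambda>(t, x). \<Psi> t x) p \<in> W}"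
    have "\<exists>A N. openin T A \<and> openin ?K N \<and> t \<in> A \<and> x \<in> N \<and> A \<times> N \<subseteq> ?P" if "(t, x) \<in> ?P" for t x
    proof -
      have t: "t \<in> topspace T" and x: "x \<in> topspace ?K" "\<Psi> t x \<in> W"
        using that by auto
      have "openin ?K {x \<in> topspace ?K. \<Psi> t x \<in> W}"
        using openin_continuous_map_preimage[OF continuous_map_from_subtopology[OF \<Psi>c[OF t]] W] .
      then obtain N M where NM: "openin ?K N" "closedin ?K M" "x \<in> N" "N \<subseteq> M"
        "M \<subseteq> {x \<in> topspace ?K. \<Psi> t x \<in> W}"
        using nb x unfolding neighbourhood_base_of by (metis (no_types, lifting) mem_Collect_eq)
      have "compactin ?K M"
        using NM(2) K closedin_compact_space compactin_subspace by blast
      then have M: "compactin X M"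
        by (simp add: compactin_subtopology)
      let ?A = "{t \<in> topspace T. \<Psi> t \<in> {f \<in> cmaps X Y. f ` M \<subseteq> W}}"
      have "openin T ?A"
        using openin_continuous_map_preimage[OF \<Psi> openin_compact_open_topology[OF M W]] .
      moreover have "t \<in> ?A"
        using t \<Psi> NM(5) by (auto simp: continuous_map_def)
      moreover have "?A \<times> N \<subseteq> ?P"
        using NM by fastforce
      ultimately show ?thesis using NM by blast
    qed
    then show "openin (prod_topology T ?K) ?P"
      by (subst openin_prod_topology_alt) blast
  qed
qed

section \<open>Locally convex spaces\<close>

locale lcs =
  fixes E :: "'e::real_vector topology"
  assumes locally_convex: "locally_convex_space E"
begin

lemma subspace_E: "subspace (topspace E)"
  and Hausdorff_E: "Hausdorff_space E"
  and continuous_map_plus: "continuous_map (prod_topology E E) E (\<lambda>(x, y). x + y)"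
  and continuous_map_mult: "continuous_map (prod_topology euclideanreal E) E (\<lambda>(a, x). a *\<^sub>R x)"
  using locally_convex by (auto simp: locally_convex_space_def)

lemma continuous_map_add:
  assumes "continuous_map X E f" and "continuous_map X E g"
  shows "continuous_map X E (\<lambda>x. f x + g x)"
proof -
  have "continuous_map X (prod_topology E E) (\<lambda>x. (f x, g x))"
    using assms by (simp add: continuous_map_pairwise o_def)
  from continuous_map_compose[OF this continuous_map_plus] show ?thesis by (simp add: o_def)
qed

lemma continuous_map_scaleR:
  assumes "continuous_map X euclideanreal a" and "continuous_map X E g"
  shows "continuous_map X E (\<lambda>x. a x *\<^sub>R g x)"
proof -
  have "continuous_map X (prod_topology euclideanreal E) (\<lambda>x. (a x, g x))"
    using assms by (simp add: continuous_map_pairwise o_def)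
  from continuous_map_compose[OF this continuous_map_mult] show ?thesis by (simp add: o_def)
qed

lemma continuous_map_scaleR_const:
  "continuous_map X E g \<Longrightarrow> continuous_map X E (\<lambda>x. a *\<^sub>R g x)"
  by (rule continuous_map_scaleR) auto

lemma continuous_map_diff:
  assumes "continuous_map X E f" and "continuous_map X E g"
  shows "continuous_map X E (\<lambda>x. f x - g x)"
  using continuous_map_add[OF assms(1) continuous_map_scaleR_const[OF assms(2), of "-1"]] by simp

lemma limitin_add:
  assumes "limitin E f a F" and "limitin E g b F"
  shows "limitin E (\<lambda>t. f t + g t) (a + b) F"
proof -
  have "limitin (prod_topology E E) (\<lambda>t. (f t, g t)) (a, b) F"
    using assms by (simp add: limitin_pairwise o_def)
  from continuous_map_limit[OF continuous_map_plus this] show ?thesis by (simp add: o_def)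
qed

lemma limitin_scaleR:
  assumes "limitin E f a F"
  shows "limitin E (\<lambda>t. c *\<^sub>R f t) (c *\<^sub>R a) F"
proof -
  have "continuous_map E E (\<lambda>x. c *\<^sub>R x)"
    by (rule continuous_map_scaleR_const) (simp add: id_def[symmetric])
  from continuous_map_limit[OF this assms] show ?thesis by (simp add: o_def)
qed

lemma limitin_diff:
  assumes "limitin E f a F" and "limitin E g b F"
  shows "limitin E (\<lambda>t. f t - g t) (a - b) F"
  using limitin_add[OF assms(1) limitin_scaleR[OF assms(2), of "-1"]] by simp

lemma openin_affine_vimage:
  assumes "openin E C" and "w \<in> topspace E"
  shows "openin E {x \<in> topspace E. a *\<^sub>R x + w \<in> C}"
  by (rule openin_continuous_map_preimage[OF _ assms(1)])
     (intro continuous_map_add continuous_map_scaleR_const,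
       use assms in \<open>simp_all add: id_def[symmetric]\<close>)

section \<open>Convex neighbourhoods and their gauges\<close>

lemma convex_neighbourhood:
  assumes "openin E W" and "w \<in> W"
  obtains C where "openin E C" "convex C" "w \<in> C" "C \<subseteq> W"
proof -
  have w: "w \<in> topspace E" using assms openin_subset by blast
  let ?W = "{x \<in> topspace E. 1 *\<^sub>R x + w \<in> W}"
  have "openin E ?W" "0 \<in> ?W"
    using openin_affine_vimage[OF assms(1) w, of 1] assms(2) subspace_E by (auto simp: subspace_def)
  then obtain C where C: "openin E C" "convex C" "0 \<in> C" "C \<subseteq> ?W"
    using locally_convex unfolding locally_convex_space_def by metis
  let ?C = "{x \<in> topspace E. 1 *\<^sub>R x + - w \<in> C}"
  have mw: "- w \<in> topspace E" using w subspace_E by (rule subspace_neg[rotated])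
  have "?C = (+) w ` C"
    using C(4) w subspace_E by (force simp: image_iff subspace_add)
  then have "convex ?C" using C(2) by (metis convex_translation)
  moreover have "?C \<subseteq> W" using C(4) by auto
  ultimately show thesis
    using that[of ?C] openin_affine_vimage[OF C(1) mw, of 1] C(3) w by auto
qed

text \<open>Shrinking a convex neighbourhood \<open>D\<close> of \<open>w\<close> by the factor 1/2
  towards \<open>w\<close> brings its closure inside \<open>D\<close>. The closure matters in the
  exchange of derivatives, where a limit of points of \<open>C\<close> has to stay in
  \<open>W\<close>.\<close>

lemma convex_neighbourhood_closure:
  assumes "openin E W" and "w \<in> W"
  obtains C where "openin E C" "convex C" "w \<in> C" "E closure_of C \<subseteq> W"
proof -
  obtain D where D: "openin E D" "convex D" "w \<in> D" "D \<subseteq> W"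
    using convex_neighbourhood[OF assms] .
  have w: "w \<in> topspace E" and mw: "- w \<in> topspace E"
    using D openin_subset subspace_E by (blast intro: subspace_neg)+
  \<comment> \<open>The homothetic image of \<open>D\<close> with centre \<open>w\<close> and ratio
    1/2.\<close>
  let ?C = "{x \<in> topspace E. 2 *\<^sub>R x + - w \<in> D}"
  have "convex ?C"
  proof (rule convexI)
    fix x y and u v :: real
    assume *: "x \<in> ?C" "y \<in> ?C" "0 \<le> u" "0 \<le> v" "u + v = 1"
    have "2 *\<^sub>R (u *\<^sub>R x + v *\<^sub>R y) + - w = u *\<^sub>R (2 *\<^sub>R x + - w) + v *\<^sub>R (2 *\<^sub>R y + - w)"
      using *(5) by (simp add: algebra_simps flip: scaleR_add_left)
    moreover have "u *\<^sub>R (2 *\<^sub>R x + - w) + v *\<^sub>R (2 *\<^sub>R y + - w) \<in> D"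
      using * by (intro convexD[OF D(2)]) auto
    ultimately show "u *\<^sub>R x + v *\<^sub>R y \<in> ?C"
      using * subspace_E by (simp add: subspace_add subspace_scale)
  qed
  moreover have "E closure_of ?C \<subseteq> D"
  proof
    fix p assume p: "p \<in> E closure_of ?C"
    then have pE: "p \<in> topspace E" by (simp add: in_closure_of)
    \<comment> \<open>For \<open>z\<close> in both \<open>?C\<close> and \<open>?N\<close>, the
      points 2z - w and 2p - 2z + w lie in \<open>D\<close>, and \<open>p\<close> is their
      midpoint.\<close>
    let ?N = "{z \<in> topspace E. (- 2) *\<^sub>R z + (2 *\<^sub>R p + w) \<in> D}"
    have "openin E ?N"
      using D(1) pE w subspace_E by (intro openin_affine_vimage) (simp_all add: subspace_add subspace_scale)
    moreover have "p \<in> ?N" using pE D(3) by simp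
    moreover have "\<exists>z. z \<in> ?C \<and> z \<in> N" if "p \<in> N" "openin E N" for N
      using p that by (simp only: in_closure_of)
    ultimately obtain z where z: "z \<in> ?C" "z \<in> ?N"
      by meson
    have "(2 *\<^sub>R z + - w) + ((- 2) *\<^sub>R z + (2 *\<^sub>R p + w)) = 2 *\<^sub>R p"
      by (simp only: scaleR_minus_left) simp
    then have "p = (1/2) *\<^sub>R ((2 *\<^sub>R z + - w) + ((- 2) *\<^sub>R z + (2 *\<^sub>R p + w)))"
      by (simp only: scaleR_scaleR) simp
    also have "\<dots> = (1/2) *\<^sub>R (2 *\<^sub>R z + - w) + (1/2) *\<^sub>R ((- 2) *\<^sub>R z + (2 *\<^sub>R p + w))"
      by (simp only: scaleR_add_right)
    also have "\<dots> \<in> D"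
      using z by (intro convexD[OF D(2)]) auto
    finally show "p \<in> D" .
  qed
  moreover have "w \<in> ?C" using w D(3) by (simp add: scaleR_2)
  ultimately show thesis
    using that[of ?C] openin_affine_vimage[OF D(1) mw, of 2] D(4) by blast
qed

text \<open>The separating function is the Minkowski gauge of a convex neighbourhood.\<close>

lemma separating_function:
  assumes "openin E W" and "w \<in> W"
  obtains u :: "'e \<Rightarrow> real" where "continuous_map E euclideanreal u" "u w < 1"
    "\<And>x. x \<in> topspace E \<Longrightarrow> u x < 1 \<Longrightarrow> x \<in> W"
proof -
  have w: "w \<in> topspace E" using assms openin_subset by blast
  let ?W = "{x \<in> topspace E. 1 *\<^sub>R x + w \<in> W}"
  have 0: "0 \<in> topspace E" using subspace_E by (rule subspace_0)
  have "openin E ?W" "0 \<in> ?W"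
    using openin_affine_vimage[OF assms(1) w, of 1] assms(2) 0 by auto
  then obtain C where C: "openin E C" "convex C" "0 \<in> C" "C \<subseteq> ?W"
    by (rule convex_neighbourhood)
  \<comment> \<open>\<open>A x\<close> collects the t > 0 with x in tC, where \<open>C\<close> is a
    neighbourhood of 0; \<open>p\<close> is the gauge of \<open>C\<close>, and \<open>u\<close>
    below is its translate to \<open>w\<close>.\<close>
  define A where "A x = {t. 0 < t \<and> (1 / t) *\<^sub>R x \<in> C}" for x
  define p where "p x = Inf (A x)" for x
  \<comment> \<open>Openness of \<open>C\<close> along the line through \<open>x\<close>. It makes
    the strict inequality in \<open>less_iff\<close> an equivalence.\<close>
  have ray: "\<exists>e>0. \<forall>s. \<bar>s - r\<bar> < e \<longrightarrow> s *\<^sub>R x \<in> C" if "x \<in> topspace E" "r *\<^sub>R x \<in> C" for x r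
  proof -
    have "continuous_map euclideanreal E (\<lambda>s. s *\<^sub>R x)"
      using that by (intro continuous_map_scaleR) auto
    from openin_continuous_map_preimage[OF this C(1)] have "open {s. s *\<^sub>R x \<in> C}" by simp
    then show ?thesis
      using that(2) by (auto simp: open_dist dist_real_def)
  qed
  have bdd: "bdd_below (A x)" for x
    unfolding A_def by (rule bdd_belowI[of _ 0]) auto
  have ne: "A x \<noteq> {}" if x: "x \<in> topspace E" for x
  proof -
    obtain e where "e > 0" "\<forall>s. \<bar>s - 0\<bar> < e \<longrightarrow> s *\<^sub>R x \<in> C"
      using ray[OF x, of 0] C(3) by auto
    then have "2 / e \<in> A x" by (auto simp: A_def)
    then show ?thesis by auto
  qed
  \<comment> \<open>Forward: \<open>C\<close> is convex and contains 0, so it is star-shaped and x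
    in tC passes on to r > t. Backward: by openness x/r may be stretched slightly within
    \<open>C\<close>, which gives an element of \<open>A x\<close> below \<open>r\<close>.\<close>
  have less_iff: "p x < r \<longleftrightarrow> (1 / r) *\<^sub>R x \<in> C" if x: "x \<in> topspace E" and r: "r > 0" for x r
  proof
    assume "p x < r"
    then obtain t where t: "t \<in> A x" "t < r"
      using cInf_less_iff[OF ne[OF x] bdd] unfolding p_def by auto
    have "(t / r) *\<^sub>R ((1 / t) *\<^sub>R x) + (1 - t / r) *\<^sub>R 0 \<in> C"
      using t C(3) by (intro convexD[OF C(2)]) (auto simp: A_def)
    then show "(1 / r) *\<^sub>R x \<in> C" using t by (simp add: A_def)
  next
    assume "(1 / r) *\<^sub>R x \<in> C"
    then obtain e where e: "e > 0" "\<forall>s. \<bar>s - 1 / r\<bar> < e \<longrightarrow> s *\<^sub>R x \<in> C"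
      using ray[OF x] by blast
    \<comment> \<open>Any scalar strictly between 1/r and 1/r + e would do; its inverse is the
      required element of \<open>A x\<close> below \<open>r\<close>.\<close>
    let ?s = "1 / r + e / 2"
    have s: "?s > 1 / r" "?s > 0" using e that(2) by (auto intro: add_pos_pos)
    have "1 / ?s \<in> A x"
      using e s by (auto simp: A_def)
    moreover have "1 / ?s < r"
    proof -
      have "r * ?s = 1 + r * e / 2" using that(2) by (simp add: distrib_left)
      then have "1 < r * ?s" using that(2) e(1) by simp
      then show ?thesis using s(2) by (simp only: pos_divide_less_eq)
    qed
    ultimately show "p x < r"
      unfolding p_def using cInf_lower[OF _ bdd] by (meson le_less_trans)
  qed
  have p0: "p x \<ge> 0" if "x \<in> topspace E" for x
    unfolding p_def by (rule cInf_greatest[OF ne[OF that]]) (auto simp: A_def)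
  have sub: "p (x + y) < r + s"
    if x: "x \<in> topspace E" "p x < r" and y: "y \<in> topspace E" "p y < s" for x y r s
  proof -
    have rs: "r > 0" "s > 0" using p0[OF x(1)] p0[OF y(1)] x y by auto
    have "(r / (r + s)) *\<^sub>R ((1 / r) *\<^sub>R x) + (s / (r + s)) *\<^sub>R ((1 / s) *\<^sub>R y) \<in> C"
      using rs less_iff x y by (intro convexD[OF C(2)]) (auto simp: add_divide_distrib[symmetric])
    then show ?thesis
      using rs x y subspace_E by (subst less_iff) (auto simp: subspace_add scaleR_add_right)
  qed
  define u where "u x = p (x - w)" for x
  have E_diff: "x - y \<in> topspace E" if "x \<in> topspace E" "y \<in> topspace E" for x y
    using that subspace_E by (rule subspace_diff[rotated 1])
  have cdiff: "continuous_map E E (\<lambda>x. a *\<^sub>R (x - y))" "continuous_map E E (\<lambda>x. a *\<^sub>R (y - x))"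
    if "y \<in> topspace E" for a y
    using that by (intro continuous_map_scaleR_const continuous_map_diff; simp add: id_def[symmetric])+
  have "continuous_map E euclideanreal u"
    unfolding continuous_map_upper_lower_semicontinuous_lt
  proof (intro conjI allI)
    fix a
    show "openin E {x \<in> topspace E. u x < a}"
    proof (cases "a > 0")
      case True
      then have "{x \<in> topspace E. u x < a} = {x \<in> topspace E. (1 / a) *\<^sub>R (x - w) \<in> C}"
        using less_iff E_diff w by (auto simp: u_def)
      then show ?thesis
        using openin_continuous_map_preimage[OF cdiff(1)[OF w] C(1)] by simp
    next
      case False
      then have "{x \<in> topspace E. u x < a} = {}"
        using p0 E_diff w by (force simp: u_def)
      then show ?thesis by (simp only: openin_empty)
    qed
    show "openin E {x \<in> topspace E. a < u x}"
    proof (subst openin_subopen, intro ballI)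
      fix x0 assume x0: "x0 \<in> {x \<in> topspace E. a < u x}"
      \<comment> \<open>\<open>C\<close> need not be symmetric, so lower semicontinuity comes from
        subadditivity applied to x0 - w = (x0 - x) + (x - w). The gap between \<open>a\<close> and
        \<open>u x0\<close> is split evenly: p (x0 - x) < d and u x < a + d would give u x0 < a + 2d
        = u x0.\<close>
      define d where "d = (u x0 - a) / 2"
      have d: "d > 0" using x0 by (simp add: d_def)
      let ?T = "{x \<in> topspace E. (1 / d) *\<^sub>R (x0 - x) \<in> C}"
      have "openin E ?T"
        using openin_continuous_map_preimage[OF cdiff(2) C(1)] x0 by simp
      moreover have "x0 \<in> ?T" using x0 C(3) by simp
      moreover have "a < u x" if "x \<in> ?T" for x
      proof (rule ccontr)
        assume "\<not> a < u x"
        then have "p (x - w) < a + d" using d by (simp add: u_def)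
        moreover have "p (x0 - x) < d"
          using that x0 d by (subst less_iff) (auto intro: E_diff)
        ultimately have "p (x0 - x + (x - w)) < d + (a + d)"
          using that x0 w by (intro sub) (auto intro: E_diff)
        then show False by (simp add: d_def u_def)
      qed
      ultimately show "\<exists>T. openin E T \<and> x0 \<in> T \<and> T \<subseteq> {x \<in> topspace E. a < u x}"
        by (intro exI[of _ ?T]) auto
    qed
  qed
  moreover have "u w < 1"
    using less_iff[OF 0, of 1] C(3) by (simp add: u_def)
  moreover have "x \<in> W" if "x \<in> topspace E" "u x < 1" for x
    using less_iff[OF E_diff[OF that(1) w], of 1] that C(4) by (auto simp: u_def)
  ultimately show thesis by (rule that)
qed

lemma kR_space_continuous_map:
  assumes X: "kR_space X"
    and K: "\<And>K. compactin X K \<Longrightarrow> continuous_map (subtopology X K) E f"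
  shows "continuous_map X E f"
  unfolding continuous_map_def
proof (intro conjI allI impI)
  show fE: "f \<in> topspace X \<rightarrow> topspace E"
  proof
    fix x assume "x \<in> topspace X"
    with K[of "{x}"] show "f x \<in> topspace E"
      by (auto simp: continuous_map_def)
  qed
  fix W assume W: "openin E W"
  show "openin X {x \<in> topspace X. f x \<in> W}"
  proof (subst openin_subopen, intro ballI)
    fix x0 assume x0: "x0 \<in> {x \<in> topspace X. f x \<in> W}"
    then obtain u :: "'e \<Rightarrow> real" where u: "continuous_map E euclideanreal u" "u (f x0) < 1"
      "\<And>x. x \<in> topspace E \<Longrightarrow> u x < 1 \<Longrightarrow> x \<in> W"
      using separating_function[OF W] by blast
    have "continuous_map (subtopology X K) euclideanreal (\<lambda>x. u (f x))" if "compactin X K" for K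
      using continuous_map_compose[OF K[OF that] u(1)] by (simp add: o_def)
    then have "continuous_map X euclideanreal (\<lambda>x. u (f x))"
      using X unfolding kR_space_def by blast
    then have "openin X {x \<in> topspace X. u (f x) < 1}"
      by (simp add: continuous_map_upper_lower_semicontinuous_lt)
    then show "\<exists>T. openin X T \<and> x0 \<in> T \<and> T \<subseteq> {x \<in> topspace X. f x \<in> W}"
      using x0 u fE by (intro exI[of _ "{x \<in> topspace X. u (f x) < 1}"]) auto
  qed
qed

section \<open>The mean value theorem for convex sets\<close>

text \<open>As \<open>(b - a) C + (c - b) C = (c - a) C\<close> for convex \<open>C\<close>, this is a local statement.\<close>

lemma mean_value_convex:
  fixes c c' :: "real \<Rightarrow> 'e"
  assumes ab: "a < b" and C: "openin E C" "convex C"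
    and c: "\<And>s. a \<le> s \<Longrightarrow> s \<le> b \<Longrightarrow>
      limitin E (\<lambda>h. (1 / h) *\<^sub>R (c (s + h) - c s)) (c' s) (at 0) \<and> c' s \<in> C"
  obtains v where "v \<in> C" "c b - c a = (b - a) *\<^sub>R v"
proof -
  have ne: "C \<noteq> {}" using c[of a] ab by auto
  \<comment> \<open>The quotient condition is written without division so that it also makes sense
    for x = y; there any element of the nonempty set \<open>C\<close> serves.\<close>
  define P where "P x y \<longleftrightarrow> (\<exists>v\<in>C. c y - c x = (y - x) *\<^sub>R v)" for x y
  have trans: "P x z" if xy: "P x y" and yz: "P y z" and le: "x \<le> y" "y \<le> z" for x y z
  proof -
    obtain v w where v: "v \<in> C" "c y - c x = (y - x) *\<^sub>R v" and w: "w \<in> C" "c z - c y = (z - y) *\<^sub>R w"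
      using xy yz by (auto simp: P_def)
    have eq: "c z - c x = (y - x) *\<^sub>R v + (z - y) *\<^sub>R w"
      using v(2) w(2) by (simp flip: v(2) w(2))
    show ?thesis
    proof (cases "x = z")
      case True
      then show ?thesis using ne by (auto simp: P_def)
    next
      case False
      then have xz: "x < z" using le by auto
      have "((y - x) / (z - x)) *\<^sub>R v + ((z - y) / (z - x)) *\<^sub>R w \<in> C"
        using v w le xz by (intro convexD[OF C(2)]) (auto simp: add_divide_distrib[symmetric])
      moreover have "c z - c x
          = (z - x) *\<^sub>R (((y - x) / (z - x)) *\<^sub>R v + ((z - y) / (z - x)) *\<^sub>R w)"
        using xz by (simp add: eq scaleR_add_right)
      ultimately show ?thesis by (auto simp: P_def)
    qed
  qed
  \<comment> \<open>\<open>Bolzano\<close> is the bisection principle: a relation that can be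
    concatenated and holds on all short intervals around each point holds on [a, b]. The derivative
    at \<open>s\<close> controls only quotients with one end at \<open>s\<close>, so a short
    interval around \<open>s\<close> is cut at \<open>s\<close>.\<close>
  have "P a b"
  proof (rule Bolzano[OF less_imp_le[OF ab]])
    fix s assume s: "a \<le> s" "s \<le> b"
    have "\<forall>\<^sub>F h in at 0. (1 / h) *\<^sub>R (c (s + h) - c s) \<in> C"
      using c[OF s] C(1) by (auto intro: limitinD)
    then obtain d where d: "d > 0"
      "\<And>h. h \<noteq> 0 \<Longrightarrow> \<bar>h\<bar> < d \<Longrightarrow> (1 / h) *\<^sub>R (c (s + h) - c s) \<in> C"
      by (auto simp: eventually_at dist_real_def)
    have "P x y" if xy: "x \<le> s" "s \<le> y" "y - x < d" for x y
    proof -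
      have "P x s"
      proof (cases "x = s")
        case True
        then show ?thesis using ne by (auto simp: P_def)
      next
        case False
        then have "(1 / (x - s)) *\<^sub>R (c (s + (x - s)) - c s) \<in> C"
          using d(2)[of "x - s"] xy by simp
        moreover have "c s - c x = (s - x) *\<^sub>R ((1 / (x - s)) *\<^sub>R (c (s + (x - s)) - c s))"
        proof -
          have "(s - x) * (1 / (x - s)) = - 1" using False by (simp add: divide_eq_eq)
          then show ?thesis by (simp only: scaleR_scaleR) simp
        qed
        ultimately show ?thesis unfolding P_def by blast
      qed
      moreover have "P s y"
      proof (cases "s = y")
        case True
        then show ?thesis using ne by (auto simp: P_def)
      next
        case False
        then have "(1 / (y - s)) *\<^sub>R (c (s + (y - s)) - c s) \<in> C"
          using d(2)[of "y - s"] xy by simp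
        moreover have "c y - c s = (y - s) *\<^sub>R ((1 / (y - s)) *\<^sub>R (c (s + (y - s)) - c s))"
          using False by simp
        ultimately show ?thesis unfolding P_def by blast
      qed
      ultimately show ?thesis using trans xy by blast
    qed
    then show "\<exists>d>0. \<forall>x y. x \<le> s \<and> s \<le> y \<and> y - x < d \<longrightarrow> P x y"
      using d(1) by blast
  qed (use trans in blast)
  then show thesis using that by (auto simp: P_def)
qed

text \<open>For t < 0 the mean value theorem is applied on [t, 0]; both increments change sign, so
  the quotient is the same.\<close>

lemma difference_quotient_convex:
  fixes c c' :: "real \<Rightarrow> 'e"
  assumes C: "openin E C" "convex C" and t: "t \<noteq> 0"
    and c: "\<And>s. \<bar>s\<bar> \<le> \<bar>t\<bar> \<Longrightarrow>
      limitin E (\<lambda>h. (1 / h) *\<^sub>R (c (s + h) - c s)) (c' s) (at 0) \<and> c' s \<in> C"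
  shows "(1 / t) *\<^sub>R (c t - c 0) \<in> C"
proof (cases "t > 0")
  case True
  have "\<bar>s\<bar> \<le> \<bar>t\<bar>" if "0 \<le> s" "s \<le> t" for s using that by simp
  then obtain v where "v \<in> C" "c t - c 0 = (t - 0) *\<^sub>R v"
    using mean_value_convex[OF True C, of c c'] c by blast
  then show ?thesis using t by simp
next
  case False
  then have t0: "t < 0" using t by simp
  have "\<bar>s\<bar> \<le> \<bar>t\<bar>" if "t \<le> s" "s \<le> 0" for s using that by simp
  then obtain v where v: "v \<in> C" "c 0 - c t = (0 - t) *\<^sub>R v"
    using mean_value_convex[OF t0 C, of c c'] c by blast
  have "c t - c 0 = - (c 0 - c t)" by simp
  also have "\<dots> = t *\<^sub>R v" using v(2) by simp
  finally show ?thesis using t v(1) by simp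
qed

end

section \<open>Directional derivatives\<close>

lemma one_param_groups_add: "\<gamma> \<in> one_param_groups \<Longrightarrow> \<gamma> (s + t) = \<gamma> s + \<gamma> t"
  by (simp add: one_param_groups_def)

lemma one_param_groups_0: "\<gamma> \<in> one_param_groups \<Longrightarrow> \<gamma> 0 = 0"
  using one_param_groups_add[of \<gamma> 0 0] add_left_cancel[of "\<gamma> 0" "\<gamma> 0" 0] by simp

lemma eventually_one_param:
  assumes \<gamma>: "\<gamma> \<in> one_param_groups" and U: "open U" "x \<in> U"
  shows "\<exists>d>0. \<forall>t. \<bar>t\<bar> < d \<longrightarrow> x + \<gamma> t \<in> U"
proof -
  have "continuous_on UNIV (\<lambda>t. x + \<gamma> t)"
    using \<gamma> by (intro continuous_intros) (simp add: one_param_groups_def)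
  then have "open ((\<lambda>t. x + \<gamma> t) -` U)"
    using U(1) by (simp add: continuous_on_open_vimage)
  moreover have "0 \<in> (\<lambda>t. x + \<gamma> t) -` U"
    using U(2) one_param_groups_0[OF \<gamma>] by simp
  ultimately obtain d where "d > 0" and d: "ball 0 d \<subseteq> (\<lambda>t. x + \<gamma> t) -` U"
    by (rule openE)
  have "x + \<gamma> t \<in> U" if "\<bar>t\<bar> < d" for t
    using subsetD[OF d, of t] that by simp
  then show ?thesis using \<open>d > 0\<close> by blast
qed

lemma eventually_one_param_at_0:
  assumes "\<gamma> \<in> one_param_groups" and "open U" "x \<in> U"
  shows "\<forall>\<^sub>F t in at 0. x + \<gamma> t \<in> U"
  using eventually_one_param[OF assms] by (auto simp: eventually_at dist_real_def)

lemma has_D_unique: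
  "Hausdorff_space F \<Longrightarrow> has_D F \<gamma> f x v \<Longrightarrow> has_D F \<gamma> f x w \<Longrightarrow> v = w"
  unfolding has_D_def by (rule limitin_Hausdorff_unique) auto

lemma dir_D_eq:
  "Hausdorff_space F \<Longrightarrow> has_D F \<gamma> f x v \<Longrightarrow> dir_D F \<gamma> f x = v"
  unfolding dir_D_def by (blast intro: the_equality has_D_unique)

text \<open>\<open>x + \<gamma> t\<close> lies in \<open>U\<close> for small \<open>t\<close>, so
  the values off \<open>U\<close>, over which \<open>iter_D\<close> gives no control, do not
  enter.\<close>

lemma has_D_cong:
  assumes "\<gamma> \<in> one_param_groups" and "open U" "x \<in> U" and "\<And>z. z \<in> U \<Longrightarrow> f z = g z"
    and "has_D F \<gamma> f x v"
  shows "has_D F \<gamma> g x v"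
  using assms(5) unfolding has_D_def
  by (rule limitin_transform_eventually[rotated])
     (use eventually_one_param_at_0[OF assms(1-3)] assms in \<open>auto elim: eventually_mono\<close>)

lemma iter_D_has_D:
  assumes "Hausdorff_space F" and "iter_D_exists U F \<gamma> f i" and "n < i" "x \<in> U"
  shows "has_D F (\<gamma> (Suc n)) (iter_D F \<gamma> f n) x (iter_D F \<gamma> f (Suc n) x)"
  using assms dir_D_eq unfolding iter_D_exists_def by (metis iter_D.simps(2))

text \<open>The tool for computing iterated derivatives: a chain \<phi> 0, ..., \<phi> i on
  \<open>U\<close> in which each member is a directional derivative of the preceding one. Uniqueness
  of limits identifies the chain with \<open>iter_D\<close>; since they agree only on
  \<open>U\<close>, each link passes through \<open>has_D_cong\<close>.\<close>

lemma iter_D_eqI: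
  assumes F: "Hausdorff_space F" and U: "open U" and \<gamma>: "\<gamma> \<in> {1..i} \<rightarrow> one_param_groups"
    and \<phi>0: "\<And>x. x \<in> U \<Longrightarrow> \<phi> 0 x = f x"
    and \<phi>: "\<And>n x. n < i \<Longrightarrow> x \<in> U \<Longrightarrow> has_D F (\<gamma> (Suc n)) (\<phi> n) x (\<phi> (Suc n) x)"
  shows "n \<le> i \<Longrightarrow> x \<in> U \<Longrightarrow> iter_D F \<gamma> f n x = \<phi> n x"
    and "iter_D_exists U F \<gamma> f i"
proof -
  have step: "has_D F (\<gamma> (Suc n)) (iter_D F \<gamma> f n) x (\<phi> (Suc n) x)"
    if "n < i" "x \<in> U" "\<And>z. z \<in> U \<Longrightarrow> iter_D F \<gamma> f n z = \<phi> n z" for n x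
  proof (rule has_D_cong[OF _ U that(2) _ \<phi>[OF that(1,2)]])
    show "\<gamma> (Suc n) \<in> one_param_groups" using that(1) \<gamma> by auto
    show "\<phi> n z = iter_D F \<gamma> f n z" if "z \<in> U" for z
      using \<open>\<And>z. z \<in> U \<Longrightarrow> iter_D F \<gamma> f n z = \<phi> n z\<close>[OF that] by simp
  qed
  have eq: "iter_D F \<gamma> f n x = \<phi> n x" if "n \<le> i" "x \<in> U" for n x
    using that
  proof (induction n arbitrary: x)
    case (Suc n)
    then show ?case using dir_D_eq[OF F step] by simp
  qed (simp add: \<phi>0)
  then show "n \<le> i \<Longrightarrow> x \<in> U \<Longrightarrow> iter_D F \<gamma> f n x = \<phi> n x" .
  show "iter_D_exists U F \<gamma> f i"
    unfolding iter_D_exists_def using step eq by (meson less_imp_le)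
qed

lemma iter_D_cong_groups:
  "(\<And>n. n \<in> {1..i} \<Longrightarrow> \<gamma> n = \<gamma>' n) \<Longrightarrow> iter_D F \<gamma> f i = iter_D F \<gamma>' f i"
  by (induction i) auto

lemma iter_D_exists_0 [simp]: "iter_D_exists U F \<gamma> f 0"
  by (simp add: iter_D_exists_def)

section \<open>The spaces of differentiable maps and their topologies\<close>

lemma topspace_one_param_topology [simp]: "topspace one_param_topology = one_param_groups"
  by (auto simp: one_param_topology_def cmaps_def one_param_groups_def)

lemma topspace_one_param_power [simp]:
  "topspace (one_param_power i) = (\<Pi>\<^sub>E n\<in>{1..i}. one_param_groups)"
  by (simp add: one_param_power_def)

text \<open>Families of length \<open>i'\<close> are extensional on {1..i'}. To use the first
  \<open>i'\<close> members of a longer family as directions of a lower derivative, the family has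
  to be truncated.\<close>

lemma restrict_in_one_param_power:
  assumes "\<gamma> \<in> topspace (one_param_power i)" and "i' \<le> i"
  shows "restrict \<gamma> {1..i'} \<in> topspace (one_param_power i')"
  using assms by (fastforce simp: PiE_iff)

lemma one_param_powerD:
  "\<gamma> \<in> topspace (one_param_power i) \<Longrightarrow> \<gamma> \<in> {1..i} \<rightarrow> one_param_groups"
  by (auto simp: PiE_iff)

lemma Hausdorff_space_euclidean_t2: "Hausdorff_space (euclidean :: 'a::t2_space topology)"
  unfolding Hausdorff_space_def disjnt_def
proof (intro allI impI)
  fix x y :: 'a assume "x \<in> topspace euclidean \<and> y \<in> topspace euclidean \<and> x \<noteq> y"
  then obtain A B where "open A" "open B" "x \<in> A" "y \<in> B" "A \<inter> B = {}"
    using hausdorff[of x y] by auto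
  then show "\<exists>A B. openin euclidean A \<and> openin euclidean B \<and> x \<in> A \<and> y \<in> B \<and> A \<inter> B = {}"
    by (intro exI[of _ A] exI[of _ B]) simp
qed

lemma Hausdorff_space_one_param_topology: "Hausdorff_space one_param_topology"
  unfolding one_param_topology_def
  by (intro Hausdorff_space_subtopology Hausdorff_space_compact_open_topology
      Hausdorff_space_euclidean_t2)

lemma Hausdorff_space_Ck_dom: "Hausdorff_space (Ck_dom U i)"
  unfolding Ck_dom_def one_param_power_def
  by (simp add: Hausdorff_space_prod_topology Hausdorff_space_product_topology
      Hausdorff_space_one_param_topology Hausdorff_space_subtopology Hausdorff_space_euclidean_t2)

lemma topspace_Ck_dom [simp]: "topspace (Ck_dom U i) = U \<times> topspace (one_param_power i)"
  by (simp add: Ck_dom_def)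

lemma topspace_Ckl_dom [simp]:
  "topspace (Ckl_dom U V i j) =
     (U \<times> V) \<times> (topspace (one_param_power i) \<times> topspace (one_param_power j))"
  by (simp add: Ckl_dom_def)

text \<open>Continuity of \<open>f\<close> is the case \<open>i = 0\<close>, because
  \<open>one_param_power 0\<close> has the single point \<open>\<lambda>_. undefined\<close>. With
  this form all orders are treated alike.\<close>

lemma Ck_iff:
  "f \<in> Ck U F k \<longleftrightarrow> (\<forall>x. x \<notin> U \<longrightarrow> f x = 0) \<and>
     (\<forall>i. enat i \<le> k \<longrightarrow> (\<forall>\<gamma>\<in>topspace (one_param_power i). iter_D_exists U F \<gamma> f i) \<and>
       continuous_map (Ck_dom U i) F (Ck_d U F i f))"
proof -
  have pt: "topspace (one_param_power 0) = {\<lambda>_. undefined}"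
    by simp
  have "continuous_map (Ck_dom U 0) F (Ck_d U F 0 f) \<longleftrightarrow> continuous_map (top_of_set U) F f"
  proof
    assume *: "continuous_map (Ck_dom U 0) F (Ck_d U F 0 f)"
    have "continuous_map (top_of_set U) (Ck_dom U 0) (\<lambda>x. (x, \<lambda>_. undefined))"
      by (simp add: Ck_dom_def continuous_map_pairwise o_def pt del: topspace_one_param_power)
    from continuous_map_compose[OF this *] show "continuous_map (top_of_set U) F f"
      by (rule continuous_map_eq) (simp add: Ck_d_def)
  next
    assume *: "continuous_map (top_of_set U) F f"
    have "continuous_map (Ck_dom U 0) (top_of_set U) fst"
      by (simp add: Ck_dom_def continuous_map_fst)
    from continuous_map_compose[OF this *] show "continuous_map (Ck_dom U 0) F (Ck_d U F 0 f)"
      by (rule continuous_map_eq) (auto simp: Ck_d_def)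
  qed
  moreover have "enat 0 \<le> k" by (simp add: zero_enat_def[symmetric])
  ultimately show ?thesis
    unfolding Ck_def mem_Collect_eq by (metis iter_D_exists_0 less_one not_less)
qed

text \<open>Freezing one variable reduces partial derivatives to \<open>iter_D\<close>, so that the
  one-variable lemmas apply to both.\<close>

lemma mixed_D_eq:
  "iter_D_fst E \<gamma> (iter_D_snd E \<eta> f j) i (x, y) =
     iter_D E \<gamma> (\<lambda>x'. iter_D E \<eta> (\<lambda>y'. f (x', y')) j y) i x"
  "iter_D_snd E \<eta> f j (x, y) = iter_D E \<eta> (\<lambda>y'. f (x, y')) j y"
proof -
  have fst: "iter_D_fst E \<gamma> h i (x, y) = iter_D E \<gamma> (\<lambda>x'. h (x', y)) i x"
    for h :: "'b \<times> 'c \<Rightarrow> 'a" and x y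
    by (induction i arbitrary: x) (simp_all add: D_fst_def)
  have snd: "iter_D_snd E \<eta> f j (x, y) = iter_D E \<eta> (\<lambda>y'. f (x, y')) j y" for x y
    by (induction j arbitrary: y) (simp_all add: D_snd_def)
  show "iter_D_snd E \<eta> f j (x, y) = iter_D E \<eta> (\<lambda>y'. f (x, y')) j y" by (fact snd)
  show "iter_D_fst E \<gamma> (iter_D_snd E \<eta> f j) i (x, y) =
     iter_D E \<gamma> (\<lambda>x'. iter_D E \<eta> (\<lambda>y'. f (x', y')) j y) i x"
    by (simp only: fst snd)
qed

lemma mixed_D_exists_iff:
  "mixed_D_exists U V E \<gamma> \<eta> f i j \<longleftrightarrow>
     (\<forall>x\<in>U. iter_D_exists V E \<eta> (\<lambda>y. f (x, y)) j) \<and>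
     (\<forall>y\<in>V. iter_D_exists U E \<gamma> (\<lambda>x. iter_D E \<eta> (\<lambda>y'. f (x, y')) j y) i)"
proof -
  have fst: "iter_D_fst E \<gamma> h n (x, y) = iter_D E \<gamma> (\<lambda>x'. h (x', y)) n x" for h x y n
    by (induction n arbitrary: x) (simp_all add: D_fst_def)
  show ?thesis
    unfolding mixed_D_exists_def iter_D_exists_def fst mixed_D_eq by blast
qed

lemma Ckl_d_apply:
  "x \<in> U \<Longrightarrow> y \<in> V \<Longrightarrow> \<gamma> \<in> topspace (one_param_power i) \<Longrightarrow> \<eta> \<in> topspace (one_param_power j) \<Longrightarrow>
    Ckl_d U V E i j f ((x, y), \<gamma>, \<eta>) = iter_D E \<gamma> (\<lambda>x'. iter_D E \<eta> (\<lambda>y'. f (x', y')) j y) i x"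
  by (simp add: Ckl_d_def mixed_D_eq del: topspace_one_param_power)

lemma Ck_d_apply:
  "x \<in> U \<Longrightarrow> \<gamma> \<in> topspace (one_param_power i) \<Longrightarrow> Ck_d U F i f (x, \<gamma>) = iter_D F \<gamma> f i x"
  by (simp add: Ck_d_def del: topspace_one_param_power)

lemma Ckl_iff:
  "f \<in> Ckl U V E k l \<longleftrightarrow> (\<forall>p. p \<notin> U \<times> V \<longrightarrow> f p = 0) \<and>
     (\<forall>i j. enat i \<le> k \<and> enat j \<le> l \<longrightarrow>
       (\<forall>\<gamma>\<in>topspace (one_param_power i). \<forall>\<eta>\<in>topspace (one_param_power j).
          mixed_D_exists U V E \<gamma> \<eta> f i j) \<and>
       continuous_map (Ckl_dom U V i j) E (Ckl_d U V E i j f))"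
proof -
  have "continuous_map (prod_topology (top_of_set U) (top_of_set V)) E f"
    if *: "continuous_map (Ckl_dom U V 0 0) E (Ckl_d U V E 0 0 f)"
  proof -
    have "continuous_map (prod_topology (top_of_set U) (top_of_set V)) (Ckl_dom U V 0 0)
        (\<lambda>p. (p, \<lambda>_. undefined, \<lambda>_. undefined))"
      by (simp add: Ckl_dom_def continuous_map_pairwise o_def id_def[symmetric])
    from continuous_map_compose[OF this *] show ?thesis
      by (rule continuous_map_eq) (auto simp: Ckl_d_def)
  qed
  moreover have "enat 0 \<le> k" "enat 0 \<le> l" by (simp_all add: zero_enat_def[symmetric])
  ultimately show ?thesis
    unfolding Ckl_def mem_Collect_eq by blast
qed

lemma Ck_d_in_cmaps:
  assumes "f \<in> Ck U F k" and "enat i \<le> k"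
  shows "Ck_d U F i f \<in> cmaps (Ck_dom U i) F"
  using assms by (auto simp: Ck_iff cmaps_def Ck_d_def)

lemma Ckl_d_in_cmaps:
  assumes "f \<in> Ckl U V E k l" and "enat i \<le> k" "enat j \<le> l"
  shows "Ckl_d U V E i j f \<in> cmaps (Ckl_dom U V i j) E"
  using assms by (auto simp: Ckl_iff cmaps_def Ckl_d_def)

lemma continuous_map_Ck_topology_d:
  assumes "enat i \<le> k"
  shows "continuous_map (Ck_topology U F k) (compact_open_topology (Ck_dom U i) F) (Ck_d U F i)"
  unfolding Ck_topology_def using assms
  by (intro continuous_map_from_initial_topology) (auto intro: Ck_d_in_cmaps)

lemma continuous_map_Ckl_topology_d:
  assumes "enat i \<le> k" "enat j \<le> l"
  shows "continuous_map (Ckl_topology U V E k l)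
    (compact_open_topology (Ckl_dom U V i j) E) (Ckl_d U V E i j)"
  using continuous_map_from_initial_topology
    [of "(i, j)" "{(i, j). enat i \<le> k \<and> enat j \<le> l}" "\<lambda>(i, j). Ckl_d U V E i j" "Ckl U V E k l"
      "\<lambda>(i, j). compact_open_topology (Ckl_dom U V i j) E"] assms
  by (auto simp: Ckl_topology_def intro: Ckl_d_in_cmaps)

lemma continuous_map_into_Ck_topology:
  assumes "\<Psi> \<in> topspace T \<rightarrow> Ck U F k"
    and "\<And>i. enat i \<le> k \<Longrightarrow>
      continuous_map T (compact_open_topology (Ck_dom U i) F) (\<lambda>t. Ck_d U F i (\<Psi> t))"
  shows "continuous_map T (Ck_topology U F k) \<Psi>"
  unfolding Ck_topology_def using assms by (intro continuous_map_into_initial_topology) auto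

lemma continuous_map_into_Ckl_topology:
  assumes "\<Psi> \<in> topspace T \<rightarrow> Ckl U V E k l"
    and "\<And>i j. enat i \<le> k \<Longrightarrow> enat j \<le> l \<Longrightarrow>
      continuous_map T (compact_open_topology (Ckl_dom U V i j) E) (\<lambda>t. Ckl_d U V E i j (\<Psi> t))"
  shows "continuous_map T (Ckl_topology U V E k l) \<Psi>"
  unfolding Ckl_topology_def using assms by (intro continuous_map_into_initial_topology) auto

text \<open>Uncurrying over the compact set {p}. These evaluations separate the points of the
  function space and later carry its derivatives over to \<open>E\<close>.\<close>

lemma continuous_map_Ck_topology_d_apply:
  assumes "enat i \<le> k" and "p \<in> topspace (Ck_dom U i)"
  shows "continuous_map (Ck_topology U F k) F (\<lambda>f. Ck_d U F i f p)"
proof -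
  have 1: "continuous_map (prod_topology (Ck_topology U F k) (subtopology (Ck_dom U i) {p})) F
      (\<lambda>(f, x). Ck_d U F i f x)"
    using assms by (intro continuous_map_uncurry_compact_open continuous_map_Ck_topology_d
      Hausdorff_space_Ck_dom) auto
  have 2: "continuous_map (Ck_topology U F k)
      (prod_topology (Ck_topology U F k) (subtopology (Ck_dom U i) {p})) (\<lambda>f. (f, p))"
    using assms by (simp add: continuous_map_pairwise o_def id_def[symmetric])
  show ?thesis
    using continuous_map_compose[OF 2 1] by (simp add: o_def)
qed

text \<open>Members of \<open>Ck U F k\<close> vanish off \<open>U\<close>, so distinct ones differ
  at a point of \<open>U\<close>, where evaluation separates them. With the Hausdorff property
  \<open>dir_D\<close> is well determined also when the range is a function space.\<close>

lemma Hausdorff_space_Ck_topology: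
  fixes U :: "'g::{topological_group_add, t2_space} set"
  assumes "Hausdorff_space F"
  shows "Hausdorff_space (Ck_topology U F k)"
  unfolding Hausdorff_space_def topspace_Ck_topology
proof (intro allI impI)
  fix f g assume fg: "f \<in> Ck U F k \<and> g \<in> Ck U F k \<and> f \<noteq> g"
  then obtain x where x: "f x \<noteq> g x"
    by (auto simp: fun_eq_iff)
  then have xU: "x \<in> U"
    using fg unfolding Ck_iff by metis
  let ?p = "(x, \<lambda>_. undefined) :: 'g \<times> (nat \<Rightarrow> real \<Rightarrow> 'g)"
  have p: "?p \<in> topspace (Ck_dom U 0)" using xU by simp
  have k: "enat 0 \<le> k" by (simp add: zero_enat_def[symmetric])
  have d: "Ck_d U F 0 h ?p = h x" for h
    using p by (simp add: Ck_d_def)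
  have cont: "continuous_map (Ck_topology U F k) F (\<lambda>h. h x)"
    using continuous_map_Ck_topology_d_apply[OF k p, of F] by (simp add: d)
  have "h x \<in> topspace F" if "h \<in> Ck U F k" for h
    using cont that by (auto simp: continuous_map_def Pi_iff)
  then have "f x \<in> topspace F" "g x \<in> topspace F"
    using fg by blast+
  then obtain A B where A: "openin F A" "f x \<in> A" and B: "openin F B" "g x \<in> B" and AB: "disjnt A B"
    using assms x unfolding Hausdorff_space_def by metis
  let ?O = "\<lambda>W. {h \<in> topspace (Ck_topology U F k). h x \<in> W}"
  have "openin (Ck_topology U F k) (?O A)" "openin (Ck_topology U F k) (?O B)"
    using openin_continuous_map_preimage[OF cont] A B by blast+
  moreover have "f \<in> ?O A" "g \<in> ?O B" "disjnt (?O A) (?O B)"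
    using fg A B AB by (auto simp: disjnt_iff)
  ultimately show "\<exists>A B. openin (Ck_topology U F k) A \<and> openin (Ck_topology U F k) B
      \<and> f \<in> A \<and> g \<in> B \<and> disjnt A B"
    by blast
qed

subsection \<open>Linearity\<close>

context lcs
begin

lemma has_D_lincomb:
  assumes "has_D E \<gamma> f x v" and "has_D E \<gamma> g x w"
  shows "has_D E \<gamma> (\<lambda>x. a *\<^sub>R f x + b *\<^sub>R g x) x (a *\<^sub>R v + b *\<^sub>R w)"
proof -
  have "limitin E (\<lambda>t. a *\<^sub>R ((1 / t) *\<^sub>R (f (x + \<gamma> t) - f x)) + b *\<^sub>R ((1 / t) *\<^sub>R (g (x + \<gamma> t) - g x)))
      (a *\<^sub>R v + b *\<^sub>R w) (at 0)"
    using assms unfolding has_D_def by (intro limitin_add limitin_scaleR)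
  then show ?thesis
    unfolding has_D_def by (simp add: algebra_simps)
qed

lemma iter_D_lincomb:
  assumes U: "open U" and \<gamma>: "\<gamma> \<in> {1..i} \<rightarrow> one_param_groups"
    and f: "iter_D_exists U E \<gamma> f i" and g: "iter_D_exists U E \<gamma> g i"
    and h: "\<And>x. x \<in> U \<Longrightarrow> h x = a *\<^sub>R f x + b *\<^sub>R g x"
  shows "x \<in> U \<Longrightarrow> iter_D E \<gamma> h i x = a *\<^sub>R iter_D E \<gamma> f i x + b *\<^sub>R iter_D E \<gamma> g i x"
    and "iter_D_exists U E \<gamma> h i"
proof -
  let ?\<phi> = "\<lambda>n x. a *\<^sub>R iter_D E \<gamma> f n x + b *\<^sub>R iter_D E \<gamma> g n x"
  have 0: "?\<phi> 0 x = h x" if "x \<in> U" for x using h[OF that] by simp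
  have s: "has_D E (\<gamma> (Suc n)) (?\<phi> n) x (?\<phi> (Suc n) x)" if "n < i" "x \<in> U" for n x
    by (intro has_D_lincomb iter_D_has_D[OF Hausdorff_E f that] iter_D_has_D[OF Hausdorff_E g that])
  show "x \<in> U \<Longrightarrow> iter_D E \<gamma> h i x = ?\<phi> i x"
    using iter_D_eqI(1)[of E U \<gamma> i ?\<phi> h, OF Hausdorff_E U \<gamma> 0 s] by simp
  show "iter_D_exists U E \<gamma> h i"
    using iter_D_eqI(2)[of E U \<gamma> i ?\<phi> h, OF Hausdorff_E U \<gamma> 0 s] by simp
qed

lemma iter_D_zero:
  assumes U: "open U" and \<gamma>: "\<gamma> \<in> {1..i} \<rightarrow> one_param_groups"
    and h: "\<And>x. x \<in> U \<Longrightarrow> h x = 0"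
  shows "x \<in> U \<Longrightarrow> iter_D E \<gamma> h i x = 0" and "iter_D_exists U E \<gamma> h i"
proof -
  have s: "has_D E (\<gamma> (Suc n)) (\<lambda>x. 0) x 0" for n x
    using subspace_0[OF subspace_E] by (simp add: has_D_def)
  have 0: "0 = h x" if "x \<in> U" for x
    using h[OF that] by simp
  show "x \<in> U \<Longrightarrow> iter_D E \<gamma> h i x = 0"
    by (rule iter_D_eqI(1)[of E U \<gamma> i "\<lambda>_ _. 0" h, OF Hausdorff_E U \<gamma> 0 s]) auto
  show "iter_D_exists U E \<gamma> h i"
    by (rule iter_D_eqI(2)[of E U \<gamma> i "\<lambda>_ _. 0" h, OF Hausdorff_E U \<gamma> 0 s]) auto
qed

text \<open>Two-term combinations are the form of a difference quotient: with a = 1/t and b = -1/t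
  the second claim lets \<open>Ck_d\<close> pass through it.\<close>

lemma Ck_lincomb:
  fixes U :: "'g::{topological_group_add, t2_space} set"
  assumes U: "open U" and f: "f \<in> Ck U E k" and g: "g \<in> Ck U E k"
  shows "a *\<^sub>R f + b *\<^sub>R g \<in> Ck U E k"
    and "enat i \<le> k \<Longrightarrow> p \<in> topspace (Ck_dom U i) \<Longrightarrow>
      Ck_d U E i (a *\<^sub>R f + b *\<^sub>R g) p = a *\<^sub>R Ck_d U E i f p + b *\<^sub>R Ck_d U E i g p"
proof -
  let ?h = "a *\<^sub>R f + b *\<^sub>R g"
  have h: "?h x = a *\<^sub>R f x + b *\<^sub>R g x" for x by (simp add: scaleR_fun_def)
  have ex: "iter_D_exists U E \<gamma> f i" "iter_D_exists U E \<gamma> g i"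
    if "enat i \<le> k" "\<gamma> \<in> topspace (one_param_power i)" for i \<gamma>
    using f g that by (auto simp: Ck_iff simp del: topspace_one_param_power)
  have d: "Ck_d U E i ?h p = a *\<^sub>R Ck_d U E i f p + b *\<^sub>R Ck_d U E i g p"
    if i: "enat i \<le> k" and p: "p \<in> topspace (Ck_dom U i)" for i p
  proof -
    obtain x \<gamma> where p': "p = (x, \<gamma>)" "x \<in> U" "\<gamma> \<in> topspace (one_param_power i)"
      using p by (auto simp del: topspace_one_param_power)
    then show ?thesis
      using iter_D_lincomb(1)[where h = ?h, OF U one_param_powerD[OF p'(3)] ex[OF i p'(3)] h p'(2)]
      by (simp add: Ck_d_apply del: topspace_one_param_power plus_fun_apply)
  qed
  then show "enat i \<le> k \<Longrightarrow> p \<in> topspace (Ck_dom U i) \<Longrightarrow>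
      Ck_d U E i ?h p = a *\<^sub>R Ck_d U E i f p + b *\<^sub>R Ck_d U E i g p" .
  show "?h \<in> Ck U E k"
    unfolding Ck_iff
  proof (intro conjI allI impI ballI)
    fix x assume "x \<notin> U"
    then show "?h x = 0" using f g unfolding h Ck_iff by simp
  next
    fix i and \<gamma> :: "nat \<Rightarrow> real \<Rightarrow> 'g" assume *: "enat i \<le> k" "\<gamma> \<in> topspace (one_param_power i)"
    show "iter_D_exists U E \<gamma> ?h i"
      by (rule iter_D_lincomb(2)[OF U one_param_powerD[OF *(2)] ex[OF *] h])
  next
    fix i assume i: "enat i \<le> k"
    have "continuous_map (Ck_dom U i) E (\<lambda>p. a *\<^sub>R Ck_d U E i f p + b *\<^sub>R Ck_d U E i g p)"
      using f g i by (intro continuous_map_add continuous_map_scaleR_const) (auto simp: Ck_iff)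
    then show "continuous_map (Ck_dom U i) E (Ck_d U E i ?h)"
      by (rule continuous_map_eq) (simp add: d[OF i])
  qed
qed

lemma subspace_Ckl:
  fixes U :: "'g::{topological_group_add, t2_space} set"
    and V :: "'h::{topological_group_add, t2_space} set"
  assumes U: "open U" and V: "open V"
  shows "subspace (Ckl U V E k l)"
proof -
  have lc: "a *\<^sub>R f + b *\<^sub>R g \<in> Ckl U V E k l"
    if f: "f \<in> Ckl U V E k l" and g: "g \<in> Ckl U V E k l" for a b f g
  proof -
    let ?h = "a *\<^sub>R f + b *\<^sub>R g"
    have h: "?h p = a *\<^sub>R f p + b *\<^sub>R g p" for p by (simp add: scaleR_fun_def)
    have mix: "mixed_D_exists U V E \<gamma> \<eta> ?h i j" (is ?A)
      "x \<in> U \<Longrightarrow> y \<in> V \<Longrightarrow> Ckl_d U V E i j ?h ((x, y), \<gamma>, \<eta>) =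
        a *\<^sub>R Ckl_d U V E i j f ((x, y), \<gamma>, \<eta>) + b *\<^sub>R Ckl_d U V E i j g ((x, y), \<gamma>, \<eta>)"
      if ij: "enat i \<le> k" "enat j \<le> l"
        and \<gamma>: "\<gamma> \<in> topspace (one_param_power i)" and \<eta>: "\<eta> \<in> topspace (one_param_power j)"
      for i j \<gamma> \<eta> x y
    proof -
      have ex: "mixed_D_exists U V E \<gamma> \<eta> f i j" "mixed_D_exists U V E \<gamma> \<eta> g i j"
        using f g ij \<gamma> \<eta> unfolding Ckl_iff by blast+
      have ex_snd: "iter_D_exists V E \<eta> (\<lambda>y. f (x, y)) j" "iter_D_exists V E \<eta> (\<lambda>y. g (x, y)) j"
        if "x \<in> U" for x
        using ex that unfolding mixed_D_exists_iff by blast+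
      have ex_fst: "iter_D_exists U E \<gamma> (\<lambda>x. iter_D E \<eta> (\<lambda>y'. f (x, y')) j y) i"
        "iter_D_exists U E \<gamma> (\<lambda>x. iter_D E \<eta> (\<lambda>y'. g (x, y')) j y) i"
        if "y \<in> V" for y
        using ex that unfolding mixed_D_exists_iff by blast+
      \<comment> \<open>Linearity in the second variable gives, for each fixed \<open>y\<close>, the
        pointwise identity on \<open>U\<close> that linearity in the first variable takes as its
        hypothesis.\<close>
      note lin_snd = iter_D_lincomb[where h = "\<lambda>y. ?h (x, y)" for x,
          OF V one_param_powerD[OF \<eta>] ex_snd h]
      note lin_fst = iter_D_lincomb[where h = "\<lambda>x. iter_D E \<eta> (\<lambda>y'. ?h (x, y')) j y" for y,
          OF U one_param_powerD[OF \<gamma>] ex_fst lin_snd(1)]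
      have 1: "iter_D_exists V E \<eta> (\<lambda>y. ?h (x, y)) j" if "x \<in> U" for x
        by (rule lin_snd(2)) (use that in simp)+
      have 2: "iter_D_exists U E \<gamma> (\<lambda>x. iter_D E \<eta> (\<lambda>y'. ?h (x, y')) j y) i" if "y \<in> V" for y
        by (rule lin_fst(2)) (use that in simp)+
      have 3: "iter_D E \<gamma> (\<lambda>x'. iter_D E \<eta> (\<lambda>y'. ?h (x', y')) j y) i x =
          a *\<^sub>R iter_D E \<gamma> (\<lambda>x'. iter_D E \<eta> (\<lambda>y'. f (x', y')) j y) i x +
          b *\<^sub>R iter_D E \<gamma> (\<lambda>x'. iter_D E \<eta> (\<lambda>y'. g (x', y')) j y) i x"
        if "x \<in> U" "y \<in> V" for x y
        by (rule lin_fst(1)) (use that in simp)+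
      show ?A using 1 2 by (simp add: mixed_D_exists_iff)
      show "x \<in> U \<Longrightarrow> y \<in> V \<Longrightarrow> Ckl_d U V E i j ?h ((x, y), \<gamma>, \<eta>) =
        a *\<^sub>R Ckl_d U V E i j f ((x, y), \<gamma>, \<eta>) + b *\<^sub>R Ckl_d U V E i j g ((x, y), \<gamma>, \<eta>)"
        using 3 \<gamma> \<eta> by (simp add: Ckl_d_apply del: topspace_one_param_power plus_fun_apply)
    qed
    show ?thesis
      unfolding Ckl_iff
    proof (intro conjI allI impI ballI)
      fix p assume "p \<notin> U \<times> V"
      then have "f p = 0" "g p = 0"
        using f g unfolding Ckl_iff by blast+
      then show "?h p = 0" by (simp only: h) simp
    next
      fix i j assume ij: "enat i \<le> k \<and> enat j \<le> l"
      have "continuous_map (Ckl_dom U V i j) E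
          (\<lambda>p. a *\<^sub>R Ckl_d U V E i j f p + b *\<^sub>R Ckl_d U V E i j g p)"
        using f g ij by (intro continuous_map_add continuous_map_scaleR_const) (auto simp: Ckl_iff)
      then show "continuous_map (Ckl_dom U V i j) E (Ckl_d U V E i j ?h)"
        by (rule continuous_map_eq)
           (use mix(2) ij in \<open>auto simp del: topspace_one_param_power\<close>)
    qed (use mix(1) in blast)
  qed
  have "0 \<in> Ckl U V E k l"
    unfolding Ckl_iff
  proof (intro conjI allI impI ballI)
    have mix: "mixed_D_exists U V E \<gamma> \<eta> 0 i j" (is ?A)
      "x \<in> U \<Longrightarrow> y \<in> V \<Longrightarrow> Ckl_d U V E i j 0 ((x, y), \<gamma>, \<eta>) = 0"
      if \<gamma>: "\<gamma> \<in> topspace (one_param_power i)" and \<eta>: "\<eta> \<in> topspace (one_param_power j)"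
      for i j \<gamma> \<eta> x y
    proof -
      have 1: "iter_D_exists V E \<eta> (\<lambda>y. 0) j" "y \<in> V \<Longrightarrow> iter_D E \<eta> (\<lambda>y'. 0) j y = 0" for y
        by (intro iter_D_zero[OF V one_param_powerD[OF \<eta>]]; simp)+
      have 2: "iter_D_exists U E \<gamma> (\<lambda>x. iter_D E \<eta> (\<lambda>y'. 0) j y) i"
        "x \<in> U \<Longrightarrow> iter_D E \<gamma> (\<lambda>x'. iter_D E \<eta> (\<lambda>y'. 0) j y) i x = 0" if "y \<in> V" for x y
        using that by (intro iter_D_zero[OF U one_param_powerD[OF \<gamma>]]; simp add: 1(2))+
      show ?A using 1 2 by (simp add: mixed_D_exists_iff)
      show "x \<in> U \<Longrightarrow> y \<in> V \<Longrightarrow> Ckl_d U V E i j 0 ((x, y), \<gamma>, \<eta>) = 0"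
        using 2(2) \<gamma> \<eta> by (simp add: Ckl_d_apply del: topspace_one_param_power)
    qed
    fix i j
    show "mixed_D_exists U V E \<gamma> \<eta> 0 i j"
      if "\<gamma> \<in> topspace (one_param_power i)" "\<eta> \<in> topspace (one_param_power j)" for \<gamma> \<eta>
      using that by (rule mix(1))
    have "continuous_map (Ckl_dom U V i j) E (\<lambda>p. 0)"
      using subspace_0[OF subspace_E] by simp
    then show "continuous_map (Ckl_dom U V i j) E (Ckl_d U V E i j 0)"
      by (rule continuous_map_eq) (use mix(2) in \<open>auto simp del: topspace_one_param_power\<close>)
  qed simp
  then show ?thesis
    using lc[of _ _ 1 1] lc[of _ _ _ 0] by (auto simp: subspace_def)
qed

end

section \<open>Mixed derivatives\<close>

context lcs
begin

text \<open>Since x + \<gamma> (s + h) = (x + \<gamma> s) + \<gamma> h, a directional derivative at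
  x + \<gamma> s is the velocity at \<open>s\<close> of the curve t \<mapsto> f (x + \<gamma> t).
  This makes the mean value theorem applicable on a group.\<close>

lemma has_D_curve:
  assumes "\<gamma> \<in> one_param_groups" and "has_D E \<gamma> f (x + \<gamma> s) v"
  shows "limitin E (\<lambda>h. (1 / h) *\<^sub>R (f (x + \<gamma> (s + h)) - f (x + \<gamma> s))) v (at 0)"
  using assms(2) by (simp add: has_D_def one_param_groups_add[OF assms(1)] add.assoc)

lemma limitin_closure_of:
  assumes "limitin E f a F" and "\<forall>\<^sub>F t in F. f t \<in> C" and "F \<noteq> bot"
  shows "a \<in> E closure_of C"
  unfolding in_closure_of
proof (intro conjI allI impI)
  show "a \<in> topspace E" using assms(1) by (rule limitin_topspace)
  fix T assume "a \<in> T \<and> openin E T"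
  then have "\<forall>\<^sub>F t in F. f t \<in> C \<and> f t \<in> T"
    using assms(2) limitinD[OF assms(1)] by (auto intro: eventually_conj)
  then show "\<exists>y. y \<in> C \<and> y \<in> T"
    using assms(3) eventually_happens' by blast
qed

lemma openin_prod_rectangle:
  assumes U: "open U" and P: "continuous_map (prod_topology (top_of_set U) X) E (\<lambda>(x, y). f x y)"
    and C: "openin E C" "f x y \<in> C" and xy: "x \<in> U" "y \<in> topspace X"
  obtains A B where "open A" "A \<subseteq> U" "x \<in> A" "openin X B" "y \<in> B"
    "\<forall>x\<in>A. \<forall>y\<in>B. f x y \<in> C"
proof -
  let ?P = "{p \<in> topspace (prod_topology (top_of_set U) X). (\<lambda>(x, y). f x y) p \<in> C}"
  have "openin (prod_topology (top_of_set U) X) ?P"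
    using openin_continuous_map_preimage[OF P C(1)] .
  moreover have "(x, y) \<in> ?P" using xy C by simp
  ultimately obtain A B where AB: "openin (top_of_set U) A" "openin X B" "x \<in> A" "y \<in> B" "A \<times> B \<subseteq> ?P"
    unfolding openin_prod_topology_alt by meson
  have "f x y \<in> C" if "x \<in> A" "y \<in> B" for x y
    using subsetD[OF AB(5), of "(x, y)"] that by simp
  moreover have "open A" "A \<subseteq> U"
    using AB(1) U by (simp_all add: openin_open_eq)
  ultimately show thesis using that[of A B] AB by blast
qed

text \<open>Schwarz' theorem: the second difference quotients of \<open>a\<close> lie, by two applications of the
  mean value theorem, in a given convex neighbourhood of \<open>d x y\<close>.\<close>

lemma has_D_commute:
  assumes U: "open U" and V: "open V"
    and \<gamma>: "\<gamma> \<in> one_param_groups" and \<eta>: "\<eta> \<in> one_param_groups"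
    and ab: "\<And>x y. x \<in> U \<Longrightarrow> y \<in> V \<Longrightarrow> has_D E \<gamma> (\<lambda>x. a x y) x (b x y)"
    and ac: "\<And>x y. x \<in> U \<Longrightarrow> y \<in> V \<Longrightarrow> has_D E \<eta> (a x) y (c x y)"
    and cd: "\<And>x y. x \<in> U \<Longrightarrow> y \<in> V \<Longrightarrow> has_D E \<gamma> (\<lambda>x. c x y) x (d x y)"
    and d: "continuous_map (prod_topology (top_of_set U) (top_of_set V)) E (\<lambda>(x, y). d x y)"
    and xy: "x \<in> U" "y \<in> V"
  shows "has_D E \<eta> (b x) y (d x y)"
  unfolding has_D_def limitin_def
proof (intro conjI allI impI)
  show "d x y \<in> topspace E"
    using cd[OF xy] by (auto simp: has_D_def limitin_def)
  fix W assume "openin E W \<and> d x y \<in> W"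
  \<comment> \<open>The closure is kept inside \<open>W\<close> because the final limit t
    \<rightarrow> 0 leaves the quotients only in the closure of \<open>C\<close>.\<close>
  then obtain C where C: "openin E C" "convex C" "d x y \<in> C" "E closure_of C \<subseteq> W"
    using convex_neighbourhood_closure[of W "d x y"] by blast
  have yV: "y \<in> topspace (top_of_set V)" using xy(2) by simp
  obtain A B where A: "open A" "A \<subseteq> U" "x \<in> A" and B: "openin (top_of_set V) B" "y \<in> B"
    and AB: "\<forall>x\<in>A. \<forall>y\<in>B. d x y \<in> C"
    using openin_prod_rectangle[OF U d C(1,3) xy(1) yV] .
  have B': "open B" "B \<subseteq> V"
    using B(1) V by (simp_all add: openin_open_eq)
  obtain p where p: "p > 0" "\<And>t. \<bar>t\<bar> < p \<Longrightarrow> x + \<gamma> t \<in> A"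
    using eventually_one_param[OF \<gamma> A(1,3)] by blast
  obtain q where q: "q > 0" "\<And>s. \<bar>s\<bar> < q \<Longrightarrow> y + \<eta> s \<in> B"
    using eventually_one_param[OF \<eta> B'(1) B(2)] by blast
  \<comment> \<open>For fixed \<open>t\<close> the velocity of s \<mapsto> H t s is the quotient of
    \<open>c\<close> in the direction \<open>\<gamma>\<close>, whose own velocity in
    \<open>t\<close> is \<open>d\<close>; on the rectangle \<open>d\<close> takes values in
    \<open>C\<close>.\<close>
  define H where "H t s = (1 / t) *\<^sub>R (a (x + \<gamma> t) (y + \<eta> s) - a x (y + \<eta> s))" for t s
  have in_C: "(1 / s) *\<^sub>R (H t s - H t 0) \<in> C"
    if s: "s \<noteq> 0" "\<bar>s\<bar> < q" and t: "t \<noteq> 0" "\<bar>t\<bar> < p" for s t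
  proof (rule difference_quotient_convex[OF C(1,2) s(1), of "H t"
        "\<lambda>s. (1 / t) *\<^sub>R (c (x + \<gamma> t) (y + \<eta> s) - c x (y + \<eta> s))"], intro conjI)
    fix s' assume "\<bar>s'\<bar> \<le> \<bar>s\<bar>"
    then have B_s': "y + \<eta> s' \<in> B" using q(2) s(2) by simp
    then have V_s': "y + \<eta> s' \<in> V" using B'(2) by blast
    have U_t: "x + \<gamma> t \<in> U" using p(2)[OF t(2)] A(2) by blast
    have "limitin E (\<lambda>h. (1 / t) *\<^sub>R
        ((1 / h) *\<^sub>R (a (x + \<gamma> t) (y + \<eta> (s' + h)) - a (x + \<gamma> t) (y + \<eta> s'))
         - (1 / h) *\<^sub>R (a x (y + \<eta> (s' + h)) - a x (y + \<eta> s'))))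
        ((1 / t) *\<^sub>R (c (x + \<gamma> t) (y + \<eta> s') - c x (y + \<eta> s'))) (at 0)"
      by (intro limitin_scaleR limitin_diff has_D_curve[OF \<eta>] ac U_t V_s' xy(1))
    moreover have "(1 / t) *\<^sub>R
        ((1 / h) *\<^sub>R (a (x + \<gamma> t) (y + \<eta> (s' + h)) - a (x + \<gamma> t) (y + \<eta> s'))
         - (1 / h) *\<^sub>R (a x (y + \<eta> (s' + h)) - a x (y + \<eta> s')))
        = (1 / h) *\<^sub>R (H t (s' + h) - H t s')" for h
    proof -
      have *: "\<alpha> *\<^sub>R (\<beta> *\<^sub>R (z1 - z2) - \<beta> *\<^sub>R (z3 - z4)) = \<beta> *\<^sub>R (\<alpha> *\<^sub>R (z1 - z3) - \<alpha> *\<^sub>R (z2 - z4))"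
        for \<alpha> \<beta> :: real and z1 z2 z3 z4 :: 'e
        by (simp add: scaleR_diff_right mult.commute)
      show ?thesis unfolding H_def by (rule *)
    qed
    ultimately show "limitin E (\<lambda>h. (1 / h) *\<^sub>R (H t (s' + h) - H t s'))
        ((1 / t) *\<^sub>R (c (x + \<gamma> t) (y + \<eta> s') - c x (y + \<eta> s'))) (at 0)"
      by simp
    have "(1 / t) *\<^sub>R (c (x + \<gamma> t) (y + \<eta> s') - c (x + \<gamma> 0) (y + \<eta> s')) \<in> C"
    proof (rule difference_quotient_convex[OF C(1,2) t(1), of "\<lambda>t. c (x + \<gamma> t) (y + \<eta> s')"
          "\<lambda>t. d (x + \<gamma> t) (y + \<eta> s')"], intro conjI)
      fix t' assume "\<bar>t'\<bar> \<le> \<bar>t\<bar>"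
      then have A_t': "x + \<gamma> t' \<in> A" using p(2) t(2) by simp
      then show "d (x + \<gamma> t') (y + \<eta> s') \<in> C" using AB B_s' by blast
      have "x + \<gamma> t' \<in> U" using A_t' A(2) by blast
      then show "limitin E (\<lambda>h. (1 / h) *\<^sub>R (c (x + \<gamma> (t' + h)) (y + \<eta> s') - c (x + \<gamma> t') (y + \<eta> s')))
          (d (x + \<gamma> t') (y + \<eta> s')) (at 0)"
        using has_D_curve[OF \<gamma> cd[OF _ V_s']] by blast
    qed
    then show "(1 / t) *\<^sub>R (c (x + \<gamma> t) (y + \<eta> s') - c x (y + \<eta> s')) \<in> C"
      by (simp add: one_param_groups_0[OF \<gamma>])
  qed
  \<comment> \<open>Here \<open>s\<close> is fixed and t \<rightarrow> 0, which turns H t s into b x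
    (y + \<eta> s). The bound \<open>q\<close> on \<open>s\<close> was chosen independently of
    \<open>t\<close>.\<close>
  have "(1 / s) *\<^sub>R (b x (y + \<eta> s) - b x y) \<in> W" if s: "s \<noteq> 0" "\<bar>s\<bar> < q" for s
  proof -
    have V_s: "y + \<eta> s \<in> V" using q(2)[OF s(2)] B'(2) by blast
    have "limitin E (\<lambda>t. H t s) (b x (y + \<eta> s)) (at 0)"
      using ab[OF xy(1) V_s] by (simp add: has_D_def H_def)
    moreover have "limitin E (\<lambda>t. H t 0) (b x y) (at 0)"
      using ab[OF xy] by (simp add: has_D_def H_def one_param_groups_0[OF \<eta>])
    ultimately have "limitin E (\<lambda>t. (1 / s) *\<^sub>R (H t s - H t 0)) ((1 / s) *\<^sub>R (b x (y + \<eta> s) - b x y)) (at 0)"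
      by (intro limitin_scaleR limitin_diff)
    moreover have "\<forall>\<^sub>F t in at 0. (1 / s) *\<^sub>R (H t s - H t 0) \<in> C"
      using in_C[OF s] p(1) by (auto simp: eventually_at dist_real_def)
    ultimately have "(1 / s) *\<^sub>R (b x (y + \<eta> s) - b x y) \<in> E closure_of C"
      by (rule limitin_closure_of) simp
    then show ?thesis using C(4) by blast
  qed
  then show "\<forall>\<^sub>F s in at 0. (1 / s) *\<^sub>R (b x (y + \<eta> s) - b x y) \<in> W"
    using q(1) by (auto simp: eventually_at dist_real_def)
qed

text \<open>Near each \<open>y\<close> in \<open>K\<close> the derivative stays in one convex subset
  of \<open>W\<close>, so the mean value theorem controls the quotients for all parameters in a
  neighbourhood of \<open>y\<close> with one common range of \<open>t\<close>. Compactness leaves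
  finitely many such ranges to intersect.\<close>

lemma difference_quotient_compact:
  assumes U: "open U" "x \<in> U" and \<gamma>: "\<gamma> \<in> one_param_groups"
    and AB: "\<And>x y. x \<in> U \<Longrightarrow> y \<in> topspace X \<Longrightarrow> has_D E \<gamma> (\<lambda>x. A x y) x (B x y)"
    and B: "continuous_map (prod_topology (top_of_set U) X) E (\<lambda>(x, y). B x y)"
    and K: "compactin X K" and W: "openin E W" and BW: "\<And>y. y \<in> K \<Longrightarrow> B x y \<in> W"
  shows "\<forall>\<^sub>F t in at 0. \<forall>y\<in>K. (1 / t) *\<^sub>R (A (x + \<gamma> t) y - A x y) \<in> W"
proof -
  let ?Q = "\<lambda>t y. (1 / t) *\<^sub>R (A (x + \<gamma> t) y - A x y)"
  let ?good = "\<lambda>N. \<forall>\<^sub>F t in at 0. \<forall>z\<in>N. ?Q t z \<in> W"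
  have nb: "\<exists>N. openin X N \<and> y \<in> N \<and> ?good N" if y: "y \<in> K" for y
  proof -
    have yX: "y \<in> topspace X" using y compactin_subset_topspace[OF K] by blast
    obtain C where C: "openin E C" "convex C" "B x y \<in> C" "C \<subseteq> W"
      using convex_neighbourhood[OF W BW[OF y]] .
    obtain M N where M: "open M" "M \<subseteq> U" "x \<in> M" and N: "openin X N" "y \<in> N"
      and MN: "\<forall>x\<in>M. \<forall>y\<in>N. B x y \<in> C"
      using openin_prod_rectangle[OF U(1) B C(1,3) U(2) yX] .
    obtain p where p: "p > 0" "\<And>t. \<bar>t\<bar> < p \<Longrightarrow> x + \<gamma> t \<in> M"
      using eventually_one_param[OF \<gamma> M(1,3)] by blast
    have "?Q t z \<in> W" if t: "t \<noteq> 0" "\<bar>t\<bar> < p" and z: "z \<in> N" for t z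
    proof -
      have zX: "z \<in> topspace X" using z openin_subset[OF N(1)] by blast
      have "(1 / t) *\<^sub>R (A (x + \<gamma> t) z - A (x + \<gamma> 0) z) \<in> C"
      proof (rule difference_quotient_convex[OF C(1,2) t(1), of "\<lambda>t. A (x + \<gamma> t) z"
            "\<lambda>t. B (x + \<gamma> t) z"], intro conjI)
        fix s assume "\<bar>s\<bar> \<le> \<bar>t\<bar>"
        then have s: "x + \<gamma> s \<in> M" using p(2) t(2) by simp
        then show "B (x + \<gamma> s) z \<in> C" using MN z by blast
        have "x + \<gamma> s \<in> U" using s M(2) by blast
        then show "limitin E (\<lambda>h. (1 / h) *\<^sub>R (A (x + \<gamma> (s + h)) z - A (x + \<gamma> s) z))
            (B (x + \<gamma> s) z) (at 0)"
          using has_D_curve[OF \<gamma> AB[OF _ zX]] by blast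
      qed
      then show ?thesis using C(4) by (auto simp: one_param_groups_0[OF \<gamma>])
    qed
    then have "?good N"
      using p(1) by (auto simp: eventually_at dist_real_def)
    then show ?thesis using N by blast
  qed
  let ?\<N> = "{N. openin X N \<and> ?good N}"
  have "K \<subseteq> \<Union>?\<N>" using nb by blast
  then obtain \<F> where \<F>: "finite \<F>" "\<F> \<subseteq> ?\<N>" "K \<subseteq> \<Union>\<F>"
    using K unfolding compactin_def by (metis (no_types, lifting) mem_Collect_eq)
  then have "\<forall>\<^sub>F t in at 0. \<forall>N\<in>\<F>. \<forall>z\<in>N. ?Q t z \<in> W"
    by (intro eventually_ball_finite) auto
  then show ?thesis
    by (rule eventually_mono) (use \<F>(3) in blast)
qed

text \<open>A compact \<open>K\<close> has compact image under \<open>b\<close>, and over that image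
  evaluation is jointly continuous. Function and argument both depend on the same point of
  \<open>X\<close>, so the k_R-property is asked of the total domain and not of
  \<open>Y\<close>.\<close>

lemma kR_space_continuous_map_uncurry:
  assumes X: "kR_space X" and Y: "Hausdorff_space Y"
    and h: "continuous_map X (compact_open_topology Y E) h" and b: "continuous_map X Y b"
  shows "continuous_map X E (\<lambda>p. h p (b p))"
proof (rule kR_space_continuous_map[OF X])
  fix K assume K: "compactin X K"
  have 1: "continuous_map (prod_topology X (subtopology Y (b ` K))) E (\<lambda>(p, y). h p y)"
    using h Y image_compactin[OF K b] by (rule continuous_map_uncurry_compact_open)
  have "continuous_map (subtopology X K) (subtopology Y (b ` K)) b"
    using b by (auto simp: continuous_map_in_subtopology intro: continuous_map_from_subtopology)
  then have 2: "continuous_map (subtopology X K) (prod_topology X (subtopology Y (b ` K))) (\<lambda>p. (p, b p))"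
    by (simp add: continuous_map_paired continuous_map_from_subtopology)
  show "continuous_map (subtopology X K) E (\<lambda>p. h p (b p))"
    using continuous_map_compose[OF 2 1] by (simp add: o_def)
qed

end

section \<open>The exponential law\<close>

lemma continuous_map_fst_comp:
  "continuous_map Z (prod_topology X Y) p \<Longrightarrow> continuous_map Z X (\<lambda>z. fst (p z))"
  and continuous_map_snd_comp:
  "continuous_map Z (prod_topology X Y) p \<Longrightarrow> continuous_map Z Y (\<lambda>z. snd (p z))"
  by (simp_all add: continuous_map_pairwise o_def)

lemma continuous_map_Ckl_dom_components:
  "continuous_map (Ckl_dom U V i j) (Ck_dom U i) (\<lambda>((x, y), (\<gamma>, \<eta>)). (x, \<gamma>))"
  "continuous_map (Ckl_dom U V i j) (Ck_dom V j) (\<lambda>((x, y), (\<gamma>, \<eta>)). (y, \<eta>))"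
proof -
  have id: "continuous_map (Ckl_dom U V i j)
      (prod_topology (prod_topology (top_of_set U) (top_of_set V))
        (prod_topology (one_param_power i) (one_param_power j))) (\<lambda>p. p)"
    by (simp add: Ckl_dom_def id_def[symmetric])
  show "continuous_map (Ckl_dom U V i j) (Ck_dom U i) (\<lambda>((x, y), (\<gamma>, \<eta>)). (x, \<gamma>))"
    "continuous_map (Ckl_dom U V i j) (Ck_dom V j) (\<lambda>((x, y), (\<gamma>, \<eta>)). (y, \<eta>))"
    unfolding Ck_dom_def case_prod_unfold continuous_map_paired
    by (intro conjI continuous_map_fst_comp[OF continuous_map_fst_comp[OF id]]
      continuous_map_snd_comp[OF continuous_map_fst_comp[OF id]]
      continuous_map_fst_comp[OF continuous_map_snd_comp[OF id]]
      continuous_map_snd_comp[OF continuous_map_snd_comp[OF id]])+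
qed

lemma continuous_map_into_Ckl_dom:
  assumes "continuous_map Z (top_of_set U) x" and "continuous_map Z (top_of_set V) y"
    and "continuous_map Z (one_param_power i) \<gamma>" and "continuous_map Z (one_param_power j) \<eta>"
  shows "continuous_map Z (Ckl_dom U V i j) (\<lambda>z. ((x z, y z), (\<gamma> z, \<eta> z)))"
  using assms unfolding Ckl_dom_def continuous_map_paired by blast

lemma continuous_map_shuffle:
  "continuous_map (prod_topology (Ck_dom U i) (Ck_dom V j)) (Ckl_dom U V i j)
     (\<lambda>((x, \<gamma>), (y, \<eta>)). ((x, y), (\<gamma>, \<eta>)))"
proof -
  have id: "continuous_map (prod_topology (Ck_dom U i) (Ck_dom V j))
      (prod_topology (prod_topology (top_of_set U) (one_param_power i))
        (prod_topology (top_of_set V) (one_param_power j))) (\<lambda>p. p)"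
    by (simp add: Ck_dom_def id_def[symmetric])
  show ?thesis
    unfolding case_prod_unfold
    by (intro continuous_map_into_Ckl_dom continuous_map_fst_comp[OF continuous_map_fst_comp[OF id]]
      continuous_map_snd_comp[OF continuous_map_fst_comp[OF id]]
      continuous_map_fst_comp[OF continuous_map_snd_comp[OF id]]
      continuous_map_snd_comp[OF continuous_map_snd_comp[OF id]])
qed

lemma scaleR_diff_eq_add: "a *\<^sub>R (x - y) = a *\<^sub>R x + (- a) *\<^sub>R (y::'a::real_vector)"
  by (simp add: scaleR_diff_right)

locale exponential_law = lcs E for E :: "'e::real_vector topology" +
  fixes U :: "'g::{topological_group_add, t2_space} set"
    and V :: "'h::{topological_group_add, t2_space} set"
    and k l :: enat
  assumes open_U: "open U" and open_V: "open V"
begin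

abbreviation mixed ::
  "('g \<times> 'h \<Rightarrow> 'e) \<Rightarrow> (nat \<Rightarrow> real \<Rightarrow> 'g) \<Rightarrow> (nat \<Rightarrow> real \<Rightarrow> 'h) \<Rightarrow> nat \<Rightarrow> nat \<Rightarrow> 'g \<Rightarrow> 'h \<Rightarrow> 'e" where
  "mixed f \<gamma> \<eta> i j x y \<equiv> iter_D E \<gamma> (\<lambda>x'. iter_D E \<eta> (\<lambda>y'. f (x', y')) j y) i x"

abbreviation F :: "('h \<Rightarrow> 'e) topology" where
  "F \<equiv> Ck_topology V E l"

abbreviation trunc :: "(nat \<Rightarrow> real \<Rightarrow> 'a) \<Rightarrow> nat \<Rightarrow> nat \<Rightarrow> real \<Rightarrow> 'a" where
  "trunc \<gamma> n \<equiv> restrict \<gamma> {1..n}"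

lemma mixed_trunc: "mixed f (trunc \<gamma> i) (trunc \<eta> j) i j x y = mixed f \<gamma> \<eta> i j x y"
proof -
  have 1: "iter_D E (trunc \<eta> j) h j = iter_D E \<eta> h j" for h
    by (rule iter_D_cong_groups) simp
  have 2: "iter_D E (trunc \<gamma> i) h i = iter_D E \<gamma> h i" for h
    by (rule iter_D_cong_groups) simp
  show ?thesis by (simp only: 1 2)
qed

lemma Hausdorff_F: "Hausdorff_space F"
  by (rule Hausdorff_space_Ck_topology[OF Hausdorff_E])

lemma enat_le: "enat i \<le> k \<Longrightarrow> n \<le> i \<Longrightarrow> enat n \<le> k"
  by (meson enat_ord_simps(1) order_trans)

subsection \<open>Currying\<close>

context
  fixes f assumes f: "f \<in> Ckl U V E k l"
begin

lemma Ckl_d_trunc: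
  assumes "\<gamma> \<in> topspace (one_param_power i)" "\<eta> \<in> topspace (one_param_power j)"
    and "n \<le> i" "m \<le> j" and "x \<in> U" "y \<in> V"
  shows "Ckl_d U V E n m f ((x, y), (trunc \<gamma> n, trunc \<eta> m)) = mixed f \<gamma> \<eta> n m x y"
  by (simp only: mixed_trunc[where f = f and \<gamma> = \<gamma> and \<eta> = \<eta> and i = n and j = m] Ckl_d_apply[OF assms(5,6)
      restrict_in_one_param_power[OF assms(1,3)] restrict_in_one_param_power[OF assms(2,4)]])

text \<open>The \<open>\<gamma>\<close>-derivatives are outermost in the definition, so the next one
  is supplied by it; \<open>\<eta>\<close> is truncated to the \<open>m\<close> directions in
  use.\<close>

lemma has_D_mixed_fst:
  assumes i: "enat i \<le> k" and j: "enat j \<le> l"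
    and \<gamma>: "\<gamma> \<in> topspace (one_param_power i)" and \<eta>: "\<eta> \<in> topspace (one_param_power j)"
    and n: "n < i" and m: "m \<le> j" and xy: "x \<in> U" "y \<in> V"
  shows "has_D E (\<gamma> (Suc n)) (\<lambda>x. mixed f \<gamma> \<eta> n m x y) x (mixed f \<gamma> \<eta> (Suc n) m x y)"
proof -
  have m': "enat m \<le> l" using j m by (meson enat_ord_simps(1) order_trans)
  have "mixed_D_exists U V E \<gamma> (trunc \<eta> m) f i m"
    using f i m' \<gamma> restrict_in_one_param_power[OF \<eta> m] unfolding Ckl_iff by blast
  then have "iter_D_exists U E \<gamma> (\<lambda>x. iter_D E (trunc \<eta> m) (\<lambda>y'. f (x, y')) m y) i"
    using xy(2) unfolding mixed_D_exists_iff by blast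
  then have "iter_D_exists U E \<gamma> (\<lambda>x. iter_D E \<eta> (\<lambda>y'. f (x, y')) m y) i"
    by (subst (asm) iter_D_cong_groups[of m "trunc \<eta> m" \<eta>]) simp_all
  from iter_D_has_D[OF Hausdorff_E this n xy(1)] show ?thesis .
qed

text \<open>Before any \<open>\<gamma>\<close>-derivative is taken, the definition supplies the
  \<open>\<eta>\<close>-derivatives directly. This starts the induction below.\<close>

lemma has_D_mixed_snd_0:
  assumes j: "enat j \<le> l" and \<eta>: "\<eta> \<in> topspace (one_param_power j)"
    and m: "m < j" and xy: "x \<in> U" "y \<in> V"
  shows "has_D E (\<eta> (Suc m)) (\<lambda>y. mixed f \<gamma> \<eta> 0 m x y) y (mixed f \<gamma> \<eta> 0 (Suc m) x y)"
proof -
  have "enat 0 \<le> k" by (simp add: zero_enat_def[symmetric])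
  moreover have "(\<lambda>_. undefined) \<in> topspace (one_param_power 0)" by simp
  ultimately have "mixed_D_exists U V E (\<lambda>_. undefined) \<eta> f 0 j"
    using f j \<eta> unfolding Ckl_iff by blast
  then have "iter_D_exists V E \<eta> (\<lambda>y'. f (x, y')) j"
    using xy(1) unfolding mixed_D_exists_iff by blast
  from iter_D_has_D[OF Hausdorff_E this m xy(2)] show ?thesis by simp
qed

lemma continuous_map_mixed:
  assumes i: "enat i \<le> k" and j: "enat j \<le> l"
    and \<gamma>: "\<gamma> \<in> topspace (one_param_power i)" and \<eta>: "\<eta> \<in> topspace (one_param_power j)"
    and n: "n \<le> i" and m: "m \<le> j"
  shows "continuous_map (prod_topology (top_of_set U) (top_of_set V)) E (\<lambda>(x, y). mixed f \<gamma> \<eta> n m x y)"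
proof -
  have nm: "enat n \<le> k" "enat m \<le> l"
    using i j n m by (meson enat_ord_simps(1) order_trans)+
  have 1: "continuous_map (prod_topology (top_of_set U) (top_of_set V)) (Ckl_dom U V n m)
      (\<lambda>p. ((fst p, snd p), (trunc \<gamma> n, trunc \<eta> m)))"
    using restrict_in_one_param_power[OF \<gamma> n] restrict_in_one_param_power[OF \<eta> m]
    by (intro continuous_map_into_Ckl_dom continuous_map_fst continuous_map_snd)
       (simp_all del: topspace_one_param_power)
  have 2: "continuous_map (Ckl_dom U V n m) E (Ckl_d U V E n m f)"
    using f nm unfolding Ckl_iff by blast
  show ?thesis
    by (rule continuous_map_eq[OF continuous_map_compose[OF 1 2]])
       (use Ckl_d_trunc[OF \<gamma> \<eta> n m] in auto)
qed

text \<open>By induction on \<open>n\<close>, an \<open>\<eta>\<close>-derivative is moved past one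
  \<open>\<gamma>\<close>-derivative at a time. In the square of orders (n, m), (n+1, m), (n, m+1),
  (n+1, m+1) three sides are known, and \<open>has_D_commute\<close> yields the fourth.\<close>

lemma has_D_mixed_snd:
  assumes i: "enat i \<le> k" and j: "enat j \<le> l"
    and \<gamma>: "\<gamma> \<in> topspace (one_param_power i)" and \<eta>: "\<eta> \<in> topspace (one_param_power j)"
    and m: "m < j"
  shows "n \<le> i \<Longrightarrow> x \<in> U \<Longrightarrow> y \<in> V \<Longrightarrow>
    has_D E (\<eta> (Suc m)) (\<lambda>y. mixed f \<gamma> \<eta> n m x y) y (mixed f \<gamma> \<eta> n (Suc m) x y)"
proof (induction n arbitrary: x y)
  case 0
  show ?case using 0(2,3) by (rule has_D_mixed_snd_0[OF j \<eta> m])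
next
  case (Suc n)
  have n: "n < i" "n \<le> i" using Suc.prems(1) by auto
  have \<gamma>': "\<gamma> (Suc n) \<in> one_param_groups" and \<eta>': "\<eta> (Suc m) \<in> one_param_groups"
    using one_param_powerD[OF \<gamma>] one_param_powerD[OF \<eta>] n m by auto
  show ?case
  proof (rule has_D_commute[OF open_U open_V \<gamma>' \<eta>', of "mixed f \<gamma> \<eta> n m" _ "mixed f \<gamma> \<eta> n (Suc m)"])
    show "has_D E (\<gamma> (Suc n)) (\<lambda>x. mixed f \<gamma> \<eta> n m x y) x (mixed f \<gamma> \<eta> (Suc n) m x y)"
      if "x \<in> U" "y \<in> V" for x y
      by (rule has_D_mixed_fst[OF i j \<gamma> \<eta> n(1) _ that]) (use m in simp)
    show "has_D E (\<eta> (Suc m)) (mixed f \<gamma> \<eta> n m x) y (mixed f \<gamma> \<eta> n (Suc m) x y)"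
      if "x \<in> U" "y \<in> V" for x y
      using Suc.IH[OF n(2) that] .
    show "has_D E (\<gamma> (Suc n)) (\<lambda>x. mixed f \<gamma> \<eta> n (Suc m) x y) x (mixed f \<gamma> \<eta> (Suc n) (Suc m) x y)"
      if "x \<in> U" "y \<in> V" for x y
      by (rule has_D_mixed_fst[OF i j \<gamma> \<eta> n(1) _ that]) (use m in simp)
    show "continuous_map (prod_topology (top_of_set U) (top_of_set V)) E
        (\<lambda>(x, y). mixed f \<gamma> \<eta> (Suc n) (Suc m) x y)"
      by (rule continuous_map_mixed[OF i j \<gamma> \<eta> Suc.prems(1)]) (use m in simp)
  qed (use Suc.prems in auto)
qed

text \<open>The candidate for the \<open>n\<close>-th derivative of the curried map, taken in
  \<open>E\<close> with \<open>y\<close> frozen. It is cut off outside \<open>V\<close> because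
  members of \<open>Ck V E l\<close> vanish there.\<close>

definition curried_D :: "(nat \<Rightarrow> real \<Rightarrow> 'g) \<Rightarrow> nat \<Rightarrow> 'g \<Rightarrow> 'h \<Rightarrow> 'e" where
  "curried_D \<gamma> n x = (\<lambda>y. if y \<in> V then iter_D E \<gamma> (\<lambda>x'. f (x', y)) n x else 0)"

context
  fixes i and \<gamma> :: "nat \<Rightarrow> real \<Rightarrow> 'g" assumes i: "enat i \<le> k" and \<gamma>: "\<gamma> \<in> topspace (one_param_power i)"
begin

text \<open>The exchanged order enters here: \<open>\<eta>\<close>-derivatives are taken of a
  function that already contains \<open>\<gamma>\<close>-derivatives, along the chain provided by
  \<open>has_D_mixed_snd\<close>.\<close>

lemma iter_D_curried_D:
  assumes n: "n \<le> i" and x: "x \<in> U" and j: "enat j \<le> l" and \<eta>: "\<eta> \<in> topspace (one_param_power j)"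
  shows "y \<in> V \<Longrightarrow> iter_D E \<eta> (curried_D \<gamma> n x) j y = mixed f \<gamma> \<eta> n j x y"
    and "iter_D_exists V E \<eta> (curried_D \<gamma> n x) j"
proof -
  have 0: "mixed f \<gamma> \<eta> n 0 x y = curried_D \<gamma> n x y" if "y \<in> V" for y
    using that by (simp add: curried_D_def)
  note D = has_D_mixed_snd[OF i j \<gamma> \<eta> _ n x]
  show "y \<in> V \<Longrightarrow> iter_D E \<eta> (curried_D \<gamma> n x) j y = mixed f \<gamma> \<eta> n j x y"
    by (rule iter_D_eqI(1)[where \<phi> = "\<lambda>m. mixed f \<gamma> \<eta> n m x",
          OF Hausdorff_E open_V one_param_powerD[OF \<eta>] 0 D]) auto
  show "iter_D_exists V E \<eta> (curried_D \<gamma> n x) j"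
    by (rule iter_D_eqI(2)[where \<phi> = "\<lambda>m. mixed f \<gamma> \<eta> n m x",
          OF Hausdorff_E open_V one_param_powerD[OF \<eta>] 0 D]) auto
qed

lemma Ck_d_curried_D:
  assumes n: "n \<le> i" and x: "x \<in> U" and j: "enat j \<le> l" and y: "y \<in> V"
    and \<eta>: "\<eta> \<in> topspace (one_param_power j)"
  shows "Ck_d V E j (curried_D \<gamma> n x) (y, \<eta>) = mixed f \<gamma> \<eta> n j x y"
    and "Ck_d V E j (curried_D \<gamma> n x) (y, \<eta>) = Ckl_d U V E n j f ((x, y), (trunc \<gamma> n, \<eta>))"
proof -
  show *: "Ck_d V E j (curried_D \<gamma> n x) (y, \<eta>) = mixed f \<gamma> \<eta> n j x y"
    by (simp only: Ck_d_apply[OF y \<eta>] iter_D_curried_D(1)[OF n x j \<eta> y])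
  have "trunc \<eta> j = \<eta>"
    using \<eta> by (simp add: PiE_iff extensional_restrict)
  then show "Ck_d V E j (curried_D \<gamma> n x) (y, \<eta>) = Ckl_d U V E n j f ((x, y), (trunc \<gamma> n, \<eta>))"
    using * Ckl_d_trunc[OF \<gamma> \<eta> n order_refl x y] by simp
qed

lemma continuous_map_curried_D:
  assumes n: "n \<le> i" and j: "enat j \<le> l"
  shows "continuous_map (prod_topology (top_of_set U) (Ck_dom V j)) E
    (\<lambda>(x, q). Ck_d V E j (curried_D \<gamma> n x) q)"
proof -
  let ?X = "prod_topology (top_of_set U) (Ck_dom V j)"
  have id: "continuous_map ?X (prod_topology (top_of_set U)
      (prod_topology (top_of_set V) (one_param_power j))) (\<lambda>p. p)"
    by (simp add: Ck_dom_def id_def[symmetric])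
  have 1: "continuous_map ?X (Ckl_dom U V n j) (\<lambda>p. ((fst p, fst (snd p)), (trunc \<gamma> n, snd (snd p))))"
    using restrict_in_one_param_power[OF \<gamma> n]
    by (intro continuous_map_into_Ckl_dom continuous_map_fst_comp[OF id]
        continuous_map_fst_comp[OF continuous_map_snd_comp[OF id]]
        continuous_map_snd_comp[OF continuous_map_snd_comp[OF id]])
       (simp del: topspace_one_param_power)
  have n': "enat n \<le> k" by (rule enat_le[OF i n])
  have 2: "continuous_map (Ckl_dom U V n j) E (Ckl_d U V E n j f)"
    using f n' j unfolding Ckl_iff by blast
  show ?thesis
    by (rule continuous_map_eq[OF continuous_map_compose[OF 1 2]])
       (auto simp: Ck_d_curried_D(2)[OF n _ j] simp del: topspace_one_param_power)
qed

lemma curried_D_in_Ck: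
  assumes n: "n \<le> i" and x: "x \<in> U"
  shows "curried_D \<gamma> n x \<in> Ck V E l"
  unfolding Ck_iff
proof (intro conjI allI impI ballI)
  fix y assume "y \<notin> V" then show "curried_D \<gamma> n x y = 0" by (simp add: curried_D_def)
next
  fix j and \<eta> :: "nat \<Rightarrow> real \<Rightarrow> 'h"
  assume "enat j \<le> l" "\<eta> \<in> topspace (one_param_power j)"
  then show "iter_D_exists V E \<eta> (curried_D \<gamma> n x) j"
    by (rule iter_D_curried_D(2)[OF n x])
next
  fix j assume j: "enat j \<le> l"
  have 1: "continuous_map (Ck_dom V j) (prod_topology (top_of_set U) (Ck_dom V j)) (Pair x)"
    using x by (simp add: continuous_map_pairwise o_def id_def[symmetric])
  show "continuous_map (Ck_dom V j) E (Ck_d V E j (curried_D \<gamma> n x))"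
    using continuous_map_compose[OF 1 continuous_map_curried_D[OF n j]] by (simp add: o_def)
qed

text \<open>Convergence in \<open>F\<close> means, for each \<open>j\<close>, convergence of d^(j)
  of the quotients uniformly on compact sets. By linearity these are quotients of d^(j) of the
  values, and \<open>difference_quotient_compact\<close> applies with the pairs (y, \<eta>) as
  parameters.\<close>

lemma has_D_curried_D:
  assumes n: "n < i" and x: "x \<in> U"
  shows "has_D F (\<gamma> (Suc n)) (curried_D \<gamma> n) x (curried_D \<gamma> (Suc n) x)"
  unfolding has_D_def Ck_topology_def
proof (rule limitin_initial_topology)
  let ?\<gamma> = "\<gamma> (Suc n)"
  let ?q = "\<lambda>t. (1 / t) *\<^sub>R (curried_D \<gamma> n (x + ?\<gamma> t) - curried_D \<gamma> n x)"
  have n': "n \<le> i" "Suc n \<le> i" using n by auto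
  have \<gamma>n: "?\<gamma> \<in> one_param_groups" using one_param_powerD[OF \<gamma>] n by auto
  show "curried_D \<gamma> (Suc n) x \<in> Ck V E l" using curried_D_in_Ck[OF n'(2) x] .
  have q: "?q t = (1 / t) *\<^sub>R curried_D \<gamma> n (x + ?\<gamma> t) + (- (1 / t)) *\<^sub>R curried_D \<gamma> n x" for t
    by (simp only: scaleR_diff_eq_add)
  have U: "\<forall>\<^sub>F t in at 0. x + ?\<gamma> t \<in> U"
    by (rule eventually_one_param_at_0[OF \<gamma>n open_U x])
  have qCk: "?q t \<in> Ck V E l" if "x + ?\<gamma> t \<in> U" for t
    unfolding q by (intro Ck_lincomb(1)[OF open_V] curried_D_in_Ck[OF n'(1)] that x)
  then show "\<forall>\<^sub>F t in at 0. ?q t \<in> Ck V E l"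
    using U by (rule eventually_mono[rotated])
  fix j assume "j \<in> {j. enat j \<le> l}"
  then have j: "enat j \<le> l" by simp
  show "limitin (compact_open_topology (Ck_dom V j) E) (\<lambda>t. Ck_d V E j (?q t))
      (Ck_d V E j (curried_D \<gamma> (Suc n) x)) (at 0)"
  proof (rule limitin_compact_open_topology)
    show "Ck_d V E j (curried_D \<gamma> (Suc n) x) \<in> cmaps (Ck_dom V j) E"
      using Ck_d_in_cmaps[OF curried_D_in_Ck[OF n'(2) x] j] .
    show "\<forall>\<^sub>F t in at 0. Ck_d V E j (?q t) \<in> cmaps (Ck_dom V j) E"
      using U by (rule eventually_mono) (rule Ck_d_in_cmaps[OF qCk j])
    fix K W assume K: "compactin (Ck_dom V j) K" and W: "openin E W"
      and KW: "Ck_d V E j (curried_D \<gamma> (Suc n) x) ` K \<subseteq> W"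
    have "\<forall>\<^sub>F t in at 0. \<forall>q\<in>K. (1 / t) *\<^sub>R
        (Ck_d V E j (curried_D \<gamma> n (x + ?\<gamma> t)) q - Ck_d V E j (curried_D \<gamma> n x) q) \<in> W"
    proof (rule difference_quotient_compact[OF open_U x \<gamma>n _ continuous_map_curried_D[OF n'(2) j] K W])
      fix x' q assume x': "x' \<in> U" and "q \<in> topspace (Ck_dom V j)"
      then obtain y \<eta> where q: "q = (y, \<eta>)" "y \<in> V" and \<eta>: "\<eta> \<in> topspace (one_param_power j)"
        by (auto simp del: topspace_one_param_power)
      show "has_D E ?\<gamma> (\<lambda>x. Ck_d V E j (curried_D \<gamma> n x) q) x' (Ck_d V E j (curried_D \<gamma> (Suc n) x') q)"
        unfolding q(1) Ck_d_curried_D(1)[OF n'(2) x' j q(2) \<eta>]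
      proof (rule has_D_cong[OF \<gamma>n open_U x' _ has_D_mixed_fst[OF i j \<gamma> \<eta> n order_refl x' q(2)]])
        fix z assume "z \<in> U"
        then show "mixed f \<gamma> \<eta> n j z y = Ck_d V E j (curried_D \<gamma> n z) (y, \<eta>)"
          using Ck_d_curried_D(1)[OF n'(1) _ j q(2) \<eta>] by simp
      qed
    qed (use KW in blast)
    then show "\<forall>\<^sub>F t in at 0. Ck_d V E j (?q t) ` K \<subseteq> W"
      using U
    proof eventually_elim
      case (elim t)
      have "Ck_d V E j (?q t) p = (1 / t) *\<^sub>R
          (Ck_d V E j (curried_D \<gamma> n (x + ?\<gamma> t)) p - Ck_d V E j (curried_D \<gamma> n x) p)" if "p \<in> K" for p
      proof -
        have "p \<in> topspace (Ck_dom V j)"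
          using that compactin_subset_topspace[OF K] by blast
        then show ?thesis
          unfolding q
          by (subst Ck_lincomb(2)[OF open_V curried_D_in_Ck[OF n'(1) elim(2)] curried_D_in_Ck[OF n'(1) x] j])
             (simp_all only: scaleR_diff_eq_add)
      qed
      then show ?case using elim(1) by auto
    qed
  qed
qed

lemma iter_D_curry:
  shows "x \<in> U \<Longrightarrow> iter_D F \<gamma> (\<lambda>x y. f (x, y)) i x = curried_D \<gamma> i x"
    and "iter_D_exists U F \<gamma> (\<lambda>x y. f (x, y)) i"
proof -
  have "f (x, y) = 0" if "y \<notin> V" for x y
    using f that unfolding Ckl_iff by blast
  then have 0: "curried_D \<gamma> 0 x = (\<lambda>y. f (x, y))" if "x \<in> U" for x
    by (auto simp: curried_D_def)
  show "x \<in> U \<Longrightarrow> iter_D F \<gamma> (\<lambda>x y. f (x, y)) i x = curried_D \<gamma> i x"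
    by (rule iter_D_eqI(1)[where \<phi> = "curried_D \<gamma>",
          OF Hausdorff_F open_U one_param_powerD[OF \<gamma>] 0 has_D_curried_D]) auto
  show "iter_D_exists U F \<gamma> (\<lambda>x y. f (x, y)) i"
    by (rule iter_D_eqI(2)[where \<phi> = "curried_D \<gamma>",
          OF Hausdorff_F open_U one_param_powerD[OF \<gamma>] 0 has_D_curried_D]) auto
qed

end

lemma Ck_d_Ck_d_curry:
  assumes i: "enat i \<le> k" and j: "enat j \<le> l"
    and x: "x \<in> U" and \<gamma>: "\<gamma> \<in> topspace (one_param_power i)"
    and y: "y \<in> V" and \<eta>: "\<eta> \<in> topspace (one_param_power j)"
  shows "Ck_d V E j (Ck_d U F i (\<lambda>x y. f (x, y)) (x, \<gamma>)) (y, \<eta>) = Ckl_d U V E i j f ((x, y), (\<gamma>, \<eta>))"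
proof -
  have "trunc \<gamma> i = \<gamma>"
    using \<gamma> by (simp add: PiE_iff extensional_restrict)
  then show ?thesis
    using Ck_d_curried_D(2)[OF i \<gamma> order_refl x j y \<eta>]
    by (simp only: Ck_d_apply[OF x \<gamma>] iter_D_curry(1)[OF i \<gamma> x])
qed

lemma curry_in_Ck: "(\<lambda>x y. f (x, y)) \<in> Ck U F k"
  unfolding Ck_iff
proof (intro conjI allI impI ballI)
  fix x assume "x \<notin> U"
  then have "f (x, y) = 0" for y
    using f unfolding Ckl_iff by blast
  then show "(\<lambda>y. f (x, y)) = 0" by (simp add: zero_fun_def)
next
  fix i and \<gamma> :: "nat \<Rightarrow> real \<Rightarrow> 'g"
  assume "enat i \<le> k" "\<gamma> \<in> topspace (one_param_power i)"
  then show "iter_D_exists U F \<gamma> (\<lambda>x y. f (x, y)) i" by (rule iter_D_curry(2))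
next
  fix i assume i: "enat i \<le> k"
  let ?d = "Ck_d U F i (\<lambda>x y. f (x, y))"
  show "continuous_map (Ck_dom U i) F ?d"
  proof (rule continuous_map_into_Ck_topology)
    show "?d \<in> topspace (Ck_dom U i) \<rightarrow> Ck V E l"
      using curried_D_in_Ck[OF i _ order_refl] iter_D_curry(1)[OF i]
      by (auto simp: Ck_d_apply simp del: topspace_one_param_power)
    fix j assume j: "enat j \<le> l"
    show "continuous_map (Ck_dom U i) (compact_open_topology (Ck_dom V j) E) (\<lambda>z. Ck_d V E j (?d z))"
    \<comment> \<open>Joint continuity is given here by d^(i,j) of \<open>f\<close>, so currying
      works over the whole domain.\<close>
    proof (rule continuous_map_curry_compact_open)
      show "Ck_d V E j (?d z) \<in> extensional (topspace (Ck_dom V j))" for z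
        by (simp add: Ck_d_def)
      have "continuous_map (Ckl_dom U V i j) E (Ckl_d U V E i j f)"
        using f i j unfolding Ckl_iff by blast
      from continuous_map_compose[OF continuous_map_shuffle this]
      show "continuous_map (prod_topology (Ck_dom U i) (Ck_dom V j)) E (\<lambda>(z, w). Ck_d V E j (?d z) w)"
        by (rule continuous_map_eq)
           (auto simp: Ck_d_Ck_d_curry[OF i j] simp del: topspace_one_param_power)
    qed
  qed
qed

lemma section_in_Ck:
  assumes x: "x \<in> U"
  shows "(\<lambda>y. f (x, y)) \<in> Ck V E l"
proof -
  have "f (x, y) = 0" if "y \<notin> V" for y
    using f that unfolding Ckl_iff by blast
  then have "curried_D (\<lambda>_. undefined) 0 x = (\<lambda>y. f (x, y))"
    by (auto simp: curried_D_def)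
  then show ?thesis
    \<comment> \<open>Order 0 with the empty family of directions.\<close>
    using curried_D_in_Ck[of 0 "\<lambda>_. undefined" 0 x] x by (simp add: zero_enat_def[symmetric])
qed

end

subsection \<open>Uncurrying\<close>

text \<open>Evaluating d^(j) at \<open>p\<close> is continuous on \<open>F\<close> and linear, hence
  passes through the limit of difference quotients. Linearity is available once x + \<gamma> t lies
  in \<open>U\<close>, where \<open>h\<close> has values in the function space.\<close>

lemma has_D_evaluate:
  assumes j: "enat j \<le> l" and p: "p \<in> topspace (Ck_dom V j)" and \<gamma>: "\<gamma> \<in> one_param_groups"
    and x: "x \<in> U" and h: "\<And>x. x \<in> U \<Longrightarrow> h x \<in> Ck V E l" and D: "has_D F \<gamma> h x v"
  shows "has_D E \<gamma> (\<lambda>x. Ck_d V E j (h x) p) x (Ck_d V E j v p)"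
  unfolding has_D_def
proof (rule limitin_transform_eventually)
  have "limitin F (\<lambda>t. (1 / t) *\<^sub>R (h (x + \<gamma> t) - h x)) v (at 0)"
    using D by (simp add: has_D_def)
  from continuous_map_limit[OF continuous_map_Ck_topology_d_apply[OF j p] this]
  show "limitin E (\<lambda>t. Ck_d V E j ((1 / t) *\<^sub>R (h (x + \<gamma> t) - h x)) p) (Ck_d V E j v p) (at 0)"
    by (simp add: o_def)
  show "\<forall>\<^sub>F t in at 0. Ck_d V E j ((1 / t) *\<^sub>R (h (x + \<gamma> t) - h x)) p =
      (1 / t) *\<^sub>R (Ck_d V E j (h (x + \<gamma> t)) p - Ck_d V E j (h x) p)"
    using eventually_one_param_at_0[OF \<gamma> open_U x]
  proof eventually_elim
    case (elim t)
    have "(1 / t) *\<^sub>R (h (x + \<gamma> t) - h x) = (1 / t) *\<^sub>R h (x + \<gamma> t) + (- (1 / t)) *\<^sub>R h x"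
      by (simp only: scaleR_diff_eq_add)
    then show ?case
      using Ck_lincomb(2)[OF open_V h[OF elim] h[OF x] j p, of "1 / t" "- (1 / t)"]
      by (simp only: scaleR_diff_eq_add)
  qed
qed

context
  fixes g assumes g: "g \<in> Ck U F k"
begin

text \<open>Values of a continuous map into \<open>F\<close> lie in its carrier; so each
  intermediate derivative can in turn be differentiated on \<open>V\<close>.\<close>

lemma iter_D_in_Ck:
  assumes i: "enat i \<le> k" and \<gamma>: "\<gamma> \<in> topspace (one_param_power i)" and n: "n \<le> i" and x: "x \<in> U"
  shows "iter_D F \<gamma> g n x \<in> Ck V E l"
proof -
  have "enat n \<le> k" by (rule enat_le[OF i n])
  then have "continuous_map (Ck_dom U n) F (Ck_d U F n g)"
    using g unfolding Ck_iff by blast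
  moreover have \<gamma>n: "trunc \<gamma> n \<in> topspace (one_param_power n)"
    by (rule restrict_in_one_param_power[OF \<gamma> n])
  ultimately have "Ck_d U F n g (x, trunc \<gamma> n) \<in> topspace F"
    using x by (auto simp: continuous_map_def Pi_iff simp del: topspace_one_param_power topspace_Ck_topology)
  moreover have "iter_D F (trunc \<gamma> n) g n = iter_D F \<gamma> g n"
    by (rule iter_D_cong_groups) simp
  ultimately show ?thesis
    by (simp only: Ck_d_apply[OF x \<gamma>n] topspace_Ck_topology)
qed

text \<open>For fixed (y, \<eta>) the evaluations of the iterated derivatives of \<open>g\<close>
  form a chain starting at the \<open>j\<close>-th derivative of \<open>g x\<close>; this has the
  \<open>\<eta>\<close>-derivatives innermost, as d^(i,j) demands.\<close>

lemma uncurry_mixed_D: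
  assumes i: "enat i \<le> k" and j: "enat j \<le> l"
    and \<gamma>: "\<gamma> \<in> topspace (one_param_power i)" and \<eta>: "\<eta> \<in> topspace (one_param_power j)"
  shows "mixed_D_exists U V E \<gamma> \<eta> (\<lambda>(x, y). g x y) i j"
    and "x \<in> U \<Longrightarrow> y \<in> V \<Longrightarrow> Ckl_d U V E i j (\<lambda>(x, y). g x y) ((x, y), (\<gamma>, \<eta>))
      = Ck_d V E j (Ck_d U F i g (x, \<gamma>)) (y, \<eta>)"
proof -
  have "iter_D_exists U F \<gamma> g i"
    using g i \<gamma> unfolding Ck_iff by blast
  note D = iter_D_has_D[OF Hausdorff_F this]
  have \<gamma>n: "\<gamma> (Suc n) \<in> one_param_groups" if "n < i" for n
    using one_param_powerD[OF \<gamma>] that by auto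
  have g0: "g x \<in> Ck V E l" if "x \<in> U" for x
    using iter_D_in_Ck[OF i \<gamma> le0 that] by simp
  let ?\<phi> = "\<lambda>y n x. Ck_d V E j (iter_D F \<gamma> g n x) (y, \<eta>)"
  let ?h = "\<lambda>y x. iter_D E \<eta> (\<lambda>y'. g x y') j y"
  have 0: "?\<phi> y 0 x = ?h y x" if "y \<in> V" for x y
    using Ck_d_apply[OF that \<eta>] by simp
  have s: "has_D E (\<gamma> (Suc n)) (?\<phi> y n) x (?\<phi> y (Suc n) x)" if "y \<in> V" "n < i" "x \<in> U" for n x y
  proof (rule has_D_evaluate[OF j _ \<gamma>n[OF that(2)] that(3) iter_D_in_Ck[OF i \<gamma>] D[OF that(2,3)]])
    show "(y, \<eta>) \<in> topspace (Ck_dom V j)"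
      using that \<eta> by (simp del: topspace_one_param_power)
  qed (use that in simp)
  have 1: "iter_D E \<gamma> (?h y) i x = ?\<phi> y i x" if "x \<in> U" "y \<in> V" for x y
    by (rule iter_D_eqI(1)[where \<phi> = "?\<phi> y", OF Hausdorff_E open_U one_param_powerD[OF \<gamma>]
        0[OF that(2)] s[OF that(2)]]) (use that in simp_all)
  have 2: "iter_D_exists U E \<gamma> (?h y) i" if "y \<in> V" for y
    by (rule iter_D_eqI(2)[where \<phi> = "?\<phi> y", OF Hausdorff_E open_U one_param_powerD[OF \<gamma>]
        0[OF that] s[OF that]])
  have "iter_D_exists V E \<eta> (g x) j" if "x \<in> U" for x
    using g0[OF that] j \<eta> unfolding Ck_iff by blast
  then show "mixed_D_exists U V E \<gamma> \<eta> (\<lambda>(x, y). g x y) i j"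
    using 2 by (simp add: mixed_D_exists_iff)
  show "Ckl_d U V E i j (\<lambda>(x, y). g x y) ((x, y), (\<gamma>, \<eta>))
      = Ck_d V E j (Ck_d U F i g (x, \<gamma>)) (y, \<eta>)" if "x \<in> U" "y \<in> V"
    using 1[OF that] by (simp add: Ckl_d_apply[OF that \<gamma> \<eta>] Ck_d_apply[OF that(1) \<gamma>])
qed

lemma uncurry_in_Ckl:
  assumes kR: "\<And>i j. enat i \<le> k \<Longrightarrow> enat j \<le> l \<Longrightarrow> kR_space (Ckl_dom U V i j)"
  shows "(\<lambda>(x, y). g x y) \<in> Ckl U V E k l"
  unfolding Ckl_iff
proof (intro conjI allI impI ballI)
  have 0: "enat 0 \<le> k" "(\<lambda>_. undefined) \<in> topspace (one_param_power 0)"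
    by (simp_all add: zero_enat_def[symmetric])
  have "g x y = 0" if "x \<notin> U \<or> y \<notin> V" for x y
  proof (cases "x \<in> U")
    case True
    then have "g x \<in> Ck V E l" using iter_D_in_Ck[OF 0 le0] by simp
    then show ?thesis using True that unfolding Ck_iff by blast
  next
    case False
    then have "g x = 0" using g unfolding Ck_iff by blast
    then show ?thesis by simp
  qed
  then show "(\<lambda>(x, y). g x y) p = 0" if "p \<notin> U \<times> V" for p
    using that by (cases p) auto
next
  fix i j and \<gamma> :: "nat \<Rightarrow> real \<Rightarrow> 'g" and \<eta> :: "nat \<Rightarrow> real \<Rightarrow> 'h"
  assume "enat i \<le> k \<and> enat j \<le> l" "\<gamma> \<in> topspace (one_param_power i)"
    "\<eta> \<in> topspace (one_param_power j)"
  then show "mixed_D_exists U V E \<gamma> \<eta> (\<lambda>(x, y). g x y) i j"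
    using uncurry_mixed_D(1) by blast
next
  fix i j assume "enat i \<le> k \<and> enat j \<le> l"
  then have i: "enat i \<le> k" and j: "enat j \<le> l" by auto
  let ?a = "\<lambda>((x, y), (\<gamma>, \<eta>)). (x, \<gamma>)" and ?b = "\<lambda>((x, y), (\<gamma>, \<eta>)). (y, \<eta>)"
  have 1: "continuous_map (Ck_dom U i) F (Ck_d U F i g)"
    using g i unfolding Ck_iff by blast
  have 2: "continuous_map (Ckl_dom U V i j) (compact_open_topology (Ck_dom V j) E)
      (\<lambda>p. Ck_d V E j (Ck_d U F i g (?a p)))"
    using continuous_map_compose[OF continuous_map_compose
        [OF continuous_map_Ckl_dom_components(1) 1] continuous_map_Ck_topology_d[OF j]]
    by (simp add: o_def)
  \<comment> \<open>The derivative of \<open>g\<close> moves with (x, \<gamma>) while it is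
    evaluated at the moving point (y, \<eta>); the k_R-property makes this continuous.\<close>
  have "continuous_map (Ckl_dom U V i j) E (\<lambda>p. Ck_d V E j (Ck_d U F i g (?a p)) (?b p))"
    by (rule kR_space_continuous_map_uncurry[OF kR[OF i j] Hausdorff_space_Ck_dom 2
        continuous_map_Ckl_dom_components(2)])
  then show "continuous_map (Ckl_dom U V i j) E (Ckl_d U V E i j (\<lambda>(x, y). g x y))"
    by (rule continuous_map_eq)
       (auto simp: uncurry_mixed_D(2)[OF i j] simp del: topspace_one_param_power)
qed

end

subsection \<open>The homeomorphism\<close>

text \<open>The target topology has three layers: compact-open over \<open>Ck_dom U i\<close>,
  initial on \<open>F\<close>, and compact-open over \<open>Ck_dom V j\<close>. Peeling them off
  leaves a continuity claim on T x K x L with \<open>K\<close> and \<open>L\<close> compact.\<close>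

lemma continuous_map_curry:
  assumes H: "\<And>i j. enat i \<le> k \<Longrightarrow> enat j \<le> l \<Longrightarrow> Hausdorff_space (Ckl_dom U V i j)"
  shows "continuous_map (Ckl_topology U V E k l) (Ck_topology U F k) (\<lambda>f x y. f (x, y))"
    (is "continuous_map ?T _ ?\<Phi>")
proof (rule continuous_map_into_Ck_topology)
  show "?\<Phi> \<in> topspace ?T \<rightarrow> Ck U F k"
    using curry_in_Ck by auto
  fix i assume i: "enat i \<le> k"
  show "continuous_map ?T (compact_open_topology (Ck_dom U i) F) (\<lambda>f. Ck_d U F i (?\<Phi> f))"
  proof (rule continuous_map_into_compact_open_topology)
    show "(\<lambda>f. Ck_d U F i (?\<Phi> f)) \<in> topspace ?T \<rightarrow> cmaps (Ck_dom U i) F"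
      using Ck_d_in_cmaps[OF curry_in_Ck i] by auto
    fix K assume K: "compactin (Ck_dom U i) K"
    let ?TK = "prod_topology ?T (subtopology (Ck_dom U i) K)"
    show "continuous_map ?TK F (\<lambda>(f, z). Ck_d U F i (?\<Phi> f) z)"
    proof (rule continuous_map_into_Ck_topology)
      have KU: "K \<subseteq> topspace (Ck_dom U i)" using compactin_subset_topspace[OF K] .
      have dF: "Ck_d U F i (?\<Phi> f) z \<in> Ck V E l" if "f \<in> Ckl U V E k l" "z \<in> K" for f z
        using Ck_d_in_cmaps[OF curry_in_Ck[OF that(1)] i] that(2) KU
        unfolding cmaps_def continuous_map_def by auto
      then show "(\<lambda>(f, z). Ck_d U F i (?\<Phi> f) z) \<in> topspace ?TK \<rightarrow> Ck V E l"
        by auto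
      fix j assume j: "enat j \<le> l"
      show "continuous_map ?TK (compact_open_topology (Ck_dom V j) E)
          (\<lambda>p. Ck_d V E j (case p of (f, z) \<Rightarrow> Ck_d U F i (?\<Phi> f) z))"
      proof (rule continuous_map_into_compact_open_topology)
        show "(\<lambda>p. Ck_d V E j (case p of (f, z) \<Rightarrow> Ck_d U F i (?\<Phi> f) z))
            \<in> topspace ?TK \<rightarrow> cmaps (Ck_dom V j) E"
          using Ck_d_in_cmaps[OF dF j] by auto
        fix L assume L: "compactin (Ck_dom V j) L"
        have LV: "L \<subseteq> topspace (Ck_dom V j)" using compactin_subset_topspace[OF L] .
        let ?TKL = "prod_topology ?TK (subtopology (Ck_dom V j) L)"
        let ?\<rho> = "\<lambda>((x, \<gamma>), (y, \<eta>)). ((x, y), (\<gamma>, \<eta>))"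
        \<comment> \<open>Reordering the variables of K x L gives a compact subset of the mixed
          domain, over which d^(i,j) can be uncurried.\<close>
        have M: "compactin (Ckl_dom U V i j) (?\<rho> ` (K \<times> L))"
          using K L by (intro image_compactin[OF _ continuous_map_shuffle]) (simp add: compactin_Times)
        let ?M = "subtopology (Ckl_dom U V i j) (?\<rho> ` (K \<times> L))"
        have 1: "continuous_map (prod_topology ?T ?M) E (\<lambda>(f, p). Ckl_d U V E i j f p)"
          by (rule continuous_map_uncurry_compact_open[OF continuous_map_Ckl_topology_d[OF i j] H[OF i j] M])
        have id: "continuous_map ?TKL ?TKL (\<lambda>p. p)" by (simp add: id_def[symmetric])
        have "continuous_map ?TKL (prod_topology (Ck_dom U i) (Ck_dom V j)) (\<lambda>p. (snd (fst p), snd p))"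
          unfolding continuous_map_paired
          using continuous_map_snd_comp[OF continuous_map_fst_comp[OF id]] continuous_map_snd_comp[OF id]
          by (simp add: continuous_map_in_subtopology)
        from continuous_map_compose[OF this continuous_map_shuffle]
        have "continuous_map ?TKL ?M (\<lambda>p. ?\<rho> (snd (fst p), snd p))"
          unfolding continuous_map_in_subtopology o_def by auto
        then have 2: "continuous_map ?TKL (prod_topology ?T ?M) (\<lambda>p. (fst (fst p), ?\<rho> (snd (fst p), snd p)))"
          unfolding continuous_map_paired using continuous_map_fst_comp[OF continuous_map_fst_comp[OF id]] by blast
        show "continuous_map ?TKL E (\<lambda>(p, w). Ck_d V E j (case p of (f, z) \<Rightarrow> Ck_d U F i (?\<Phi> f) z) w)"
        proof (rule continuous_map_eq[OF continuous_map_compose[OF 2 1]])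
          fix p assume p: "p \<in> topspace ?TKL"
          obtain f x \<gamma> y \<eta> where p': "p = ((f, (x, \<gamma>)), (y, \<eta>))"
            by (metis prod.exhaust)
          have "f \<in> Ckl U V E k l" "x \<in> U" "\<gamma> \<in> topspace (one_param_power i)"
            "y \<in> V" "\<eta> \<in> topspace (one_param_power j)"
            using p unfolding p' by (auto simp del: topspace_one_param_power)
          then show "((\<lambda>(f, p). Ckl_d U V E i j f p) \<circ> (\<lambda>p. (fst (fst p), ?\<rho> (snd (fst p), snd p)))) p
              = (\<lambda>(p, w). Ck_d V E j (case p of (f, z) \<Rightarrow> Ck_d U F i (?\<Phi> f) z) w) p"
            unfolding p' by (simp add: Ck_d_Ck_d_curry[OF _ i j] del: topspace_one_param_power)
        qed
      qed
    qed
  qed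
qed

lemma continuous_map_uncurry:
  assumes kR: "\<And>i j. enat i \<le> k \<Longrightarrow> enat j \<le> l \<Longrightarrow> kR_space (Ckl_dom U V i j)"
  shows "continuous_map (Ck_topology U F k) (Ckl_topology U V E k l) (\<lambda>g (x, y). g x y)"
    (is "continuous_map ?T _ ?\<Psi>")
proof (rule continuous_map_into_Ckl_topology)
  show \<Psi>: "?\<Psi> \<in> topspace ?T \<rightarrow> Ckl U V E k l"
    using uncurry_in_Ckl[OF _ kR] by auto
  fix i j assume i: "enat i \<le> k" and j: "enat j \<le> l"
  show "continuous_map ?T (compact_open_topology (Ckl_dom U V i j) E) (\<lambda>g. Ckl_d U V E i j (?\<Psi> g))"
  proof (rule continuous_map_into_compact_open_topology)
    show "(\<lambda>g. Ckl_d U V E i j (?\<Psi> g)) \<in> topspace ?T \<rightarrow> cmaps (Ckl_dom U V i j) E"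
      using Ckl_d_in_cmaps[OF uncurry_in_Ckl[OF _ kR] i j] by auto
    fix M assume M: "compactin (Ckl_dom U V i j) M"
    have MU: "M \<subseteq> topspace (Ckl_dom U V i j)" using compactin_subset_topspace[OF M] .
    let ?a = "\<lambda>((x, y), (\<gamma>, \<eta>)). (x, \<gamma>)" and ?b = "\<lambda>((x, y), (\<gamma>, \<eta>)). (y, \<eta>)"
    \<comment> \<open>\<open>M\<close> need not be a product, but both of its projections are
      compact. Uncurrying over \<open>?K\<close> gives continuity into \<open>F\<close>; applying
      d^(j) and uncurrying over \<open>?L\<close> gives continuity into \<open>E\<close>.\<close>
    let ?K = "subtopology (Ck_dom U i) (?a ` M)" and ?L = "subtopology (Ck_dom V j) (?b ` M)"
    let ?TM = "prod_topology ?T (subtopology (Ckl_dom U V i j) M)"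
    have "continuous_map (prod_topology ?T ?K) F (\<lambda>(g, z). Ck_d U F i g z)"
      by (rule continuous_map_uncurry_compact_open[OF continuous_map_Ck_topology_d[OF i]
          Hausdorff_space_Ck_dom image_compactin[OF M continuous_map_Ckl_dom_components(1)]])
    from continuous_map_compose[OF this continuous_map_Ck_topology_d[OF j]]
    have "continuous_map (prod_topology ?T ?K) (compact_open_topology (Ck_dom V j) E)
        (\<lambda>p. Ck_d V E j (Ck_d U F i (fst p) (snd p)))"
      by (simp add: o_def case_prod_unfold)
    from continuous_map_uncurry_compact_open[OF this
        Hausdorff_space_Ck_dom image_compactin[OF M continuous_map_Ckl_dom_components(2)]]
    have 1: "continuous_map (prod_topology (prod_topology ?T ?K) ?L) E
        (\<lambda>(p, w). Ck_d V E j (Ck_d U F i (fst p) (snd p)) w)" .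
    have id: "continuous_map ?TM ?TM (\<lambda>p. p)" by (simp add: id_def[symmetric])
    have snd: "continuous_map ?TM (Ckl_dom U V i j) snd"
      using continuous_map_snd_comp[OF id] by (simp add: continuous_map_in_subtopology)
    have a: "continuous_map ?TM ?K (\<lambda>p. ?a (snd p))"
      using continuous_map_compose[OF snd continuous_map_Ckl_dom_components(1)]
      unfolding continuous_map_in_subtopology o_def by auto
    have b: "continuous_map ?TM ?L (\<lambda>p. ?b (snd p))"
      using continuous_map_compose[OF snd continuous_map_Ckl_dom_components(2)]
      unfolding continuous_map_in_subtopology o_def by auto
    have 2: "continuous_map ?TM (prod_topology (prod_topology ?T ?K) ?L) (\<lambda>p. ((fst p, ?a (snd p)), ?b (snd p)))"
      unfolding continuous_map_paired using a b continuous_map_fst by blast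
    show "continuous_map ?TM E (\<lambda>(g, p). Ckl_d U V E i j (?\<Psi> g) p)"
    proof (rule continuous_map_eq[OF continuous_map_compose[OF 2 1]])
      fix p assume p: "p \<in> topspace ?TM"
      obtain g x y \<gamma> \<eta> where p': "p = (g, ((x, y), (\<gamma>, \<eta>)))"
        by (metis prod.exhaust)
      have "g \<in> Ck U F k" "x \<in> U" "\<gamma> \<in> topspace (one_param_power i)"
        "y \<in> V" "\<eta> \<in> topspace (one_param_power j)"
        using p unfolding p' by (auto simp del: topspace_one_param_power)
      then show "((\<lambda>(p, w). Ck_d V E j (Ck_d U F i (fst p) (snd p)) w) \<circ>
          (\<lambda>p. ((fst p, ?a (snd p)), ?b (snd p)))) p = (\<lambda>(g, p). Ckl_d U V E i j (?\<Psi> g) p) p"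
        unfolding p' by (simp add: uncurry_mixed_D(2)[OF _ i j] del: topspace_one_param_power)
    qed
  qed
qed

lemma tvs_isomorphism_curry:
  assumes kR: "\<And>i j. enat i \<le> k \<Longrightarrow> enat j \<le> l \<Longrightarrow> kR_space (Ckl_dom U V i j)"
  shows "tvs_isomorphism (Ckl_topology U V E k l) (Ck_topology U F k) (\<lambda>f x y. f (x, y))"
proof -
  let ?\<Phi> = "\<lambda>f x y. f (x, y)" and ?\<Psi> = "\<lambda>g (x, y). g x y"
  have H: "Hausdorff_space (Ckl_dom U V i j)" if "enat i \<le> k" "enat j \<le> l" for i j
    using kR[OF that] unfolding kR_space_def by blast
  have "homeomorphic_maps (Ckl_topology U V E k l) (Ck_topology U F k) ?\<Phi> ?\<Psi>"
    unfolding homeomorphic_maps_def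
    using continuous_map_curry[OF H] continuous_map_uncurry[OF kR] by auto
  then have homeo: "homeomorphic_map (Ckl_topology U V E k l) (Ck_topology U F k) ?\<Phi>"
    using homeomorphic_maps_map by blast
  then have bij: "bij_betw ?\<Phi> (Ckl U V E k l) (Ck U F k)"
    using homeomorphic_imp_injective_map homeomorphic_imp_surjective_map
    by (fastforce simp: bij_betw_def)
  have add: "?\<Phi> (f + g) = ?\<Phi> f + ?\<Phi> g" and scale: "?\<Phi> (a *\<^sub>R f) = a *\<^sub>R ?\<Phi> f" for f g a
    by (simp_all add: fun_eq_iff scaleR_fun_def)
  \<comment> \<open>The subspace property of the range is transported along the linear surjection;
    \<open>Ck_lincomb\<close> would require local convexity of \<open>F\<close>.\<close>
  have "linear ?\<Phi>"
    by (rule linearI) (simp_all add: fun_eq_iff scaleR_fun_def)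
  moreover have sub: "subspace (Ckl U V E k l)"
    by (rule subspace_Ckl[OF open_U open_V])
  ultimately have "subspace (?\<Phi> ` Ckl U V E k l)"
    by (rule linear_subspace_image)
  then have subF: "subspace (Ck U F k)"
    using bij by (simp add: bij_betw_def)
  show ?thesis
    unfolding tvs_isomorphism_def topspace_Ck_topology topspace_Ckl_topology
    by (intro conjI ballI allI sub subF add scale bij homeo)
qed

end

theorem mainTheorem2:
  fixes U :: "'g::{topological_group_add, t2_space} set"
    and V :: "'h::{topological_group_add, t2_space} set"
    and E :: "'e::real_vector topology"
    and k l :: enat
  assumes "open U" and "open V"
    and "locally_convex_space E"
    and "\<And>i j. enat i \<le> k \<Longrightarrow> enat j \<le> l \<Longrightarrow> kR_space (Ckl_dom U V i j)"
  shows "(\<forall>f \<in> Ckl U V E k l.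
           (\<forall>x\<in>U. (\<lambda>y. f (x, y)) \<in> Ck V E l) \<and>
           (\<lambda>x y. f (x, y)) \<in> Ck U (Ck_topology V E l) k) \<and>
         tvs_isomorphism (Ckl_topology U V E k l) (Ck_topology U (Ck_topology V E l) k)
           (\<lambda>f x y. f (x, y))"
proof -
  interpret exponential_law E U V k l
    using assms(1-3) by unfold_locales
  show ?thesis
    using section_in_Ck curry_in_Ck tvs_isomorphism_curry[OF assms(4)] by blast
qed

end
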